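(* Let $(n_i)_{i\ge 0}$ be a sequence of positive integers with $\sup_i n_i<\infty$, let $(z_i)_{i\ge 0}$ be a sequence of complex numbers, and let $J=\bigoplus_{i=0}^\infty J_{n_i}(z_i)$ be the corresponding block diagonal operator on $\ell^2(\mathbb N_0)\cong\bigoplus_{i=0}^\infty V_i$. Let $g\in\ell^2(\mathbb N_0)$. Then the sequence $\{J^kg\}_{k=0}^\infty$ is a frame for $\ell^2(\mathbb N_0)$ if and only if both of the following hold: (1) $\{z_i\}_{i=0}^\infty\subset\mathbb D$ is a Carleson sequence; and (2) the vector $g$ is of the form $$g=\sum_{i=0}^\infty\sum_{j=0}^{n_i-1}c_{i,j}\sqrt{1-|z_i|^2}\,\delta_{i,j}$$ where $\inf_i|c_{i,0}|>0$ and $\sup_{i,j}|c_{i,j}|<\infty$.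
   Context: $\mathbb N_0=\{0,1,2,\dots\}$ and $\mathbb D$ is the open unit disc in $\mathbb C$. For each $i\ge0$, $V_i\cong\mathbb C^{n_i}$ has orthonormal basis $\{\delta_{i,j}\}_{j=0}^{n_i-1}$, and $\ell^2(\mathbb N_0)$ is identified with the orthogonal direct sum $\bigoplus_i V_i$ (concretely $\delta_{i,j}$ is the standard basis vector with index $j+\sum_{l<i}n_l$). $J_{n_i}(z_i)$ is the operator on $V_i$ with $J_{n_i}(z_i)\delta_{i,j}=z_i\delta_{i,j}+(1-|z_i|^2)\delta_{i,j+1}$ for $0\le j<n_i-1$ and $J_{n_i}(z_i)\delta_{i,n_i-1}=z_i\delta_{i,n_i-1}$ (a lower-triangular Jordan block with $z_i$ on the diagonal and $1-|z_i|^2$ on the subdiagonal). $J$ is understood to be a bounded operator on $\ell^2(\mathbb N_0)$. A sequence $\{f_k\}$ in a Hilbert space $H$ is a frame for $H$ if there are $B\ge A>0$ with $A\|h\|^2\le\sum_k|\langle h,f_k\rangle|^2\le B\|h\|^2$ for all $h\in H$. A sequence $\{z_i\}_{i\ge0}\subset\mathbb D$ is a Carleson sequence if $\inf_k\prod_{j\ne k}\left|\frac{z_j-z_k}{1-\overline{z_j}z_k}\right|>0$. *)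

theory Defs
  imports "HOL-Analysis.Analysis"
begin

subsection \<open>The Hilbert space of square-summable sequences\<close>

definition ell2 :: "(nat \<Rightarrow> complex) set" where
  "ell2 = {f. summable (\<lambda>k. (cmod (f k))\<^sup>2)}"

definition ell2_inner :: "(nat \<Rightarrow> complex) \<Rightarrow> (nat \<Rightarrow> complex) \<Rightarrow> complex" where
  "ell2_inner f h = (\<Sum>k. f k * cnj (h k))"

definition ell2_norm :: "(nat \<Rightarrow> complex) \<Rightarrow> real" where
  "ell2_norm f = sqrt (\<Sum>k. (cmod (f k))\<^sup>2)"

definition ell2_bounded_operator :: "((nat \<Rightarrow> complex) \<Rightarrow> nat \<Rightarrow> complex) \<Rightarrow> bool" where
  "ell2_bounded_operator T \<longleftrightarrow>
     (\<forall>f\<in>ell2. T f \<in> ell2) \<and>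
     (\<forall>f\<in>ell2. \<forall>h\<in>ell2. \<forall>a b. T (\<lambda>k. a * f k + b * h k) = (\<lambda>k. a * T f k + b * T h k)) \<and>
     (\<exists>C. \<forall>f\<in>ell2. ell2_norm (T f) \<le> C * ell2_norm f)"

text \<open>Summability is demanded explicitly because \<open>suminf\<close> is unspecified on divergent
  series, whereas the upper frame bound is meant to rule these out.\<close>

definition ell2_frame :: "(nat \<Rightarrow> nat \<Rightarrow> complex) \<Rightarrow> bool" where
  "ell2_frame F \<longleftrightarrow>
     (\<forall>k. F k \<in> ell2) \<and>
     (\<exists>A B. 0 < A \<and> A \<le> B \<and>
       (\<forall>h\<in>ell2. summable (\<lambda>k. (cmod (ell2_inner h (F k)))\<^sup>2) \<and>
          A * (ell2_norm h)\<^sup>2 \<le> (\<Sum>k. (cmod (ell2_inner h (F k)))\<^sup>2) \<and>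
          (\<Sum>k. (cmod (ell2_inner h (F k)))\<^sup>2) \<le> B * (ell2_norm h)\<^sup>2))"

subsection \<open>Direct sums of Jordan blocks\<close>

definition unit_vec :: "nat \<Rightarrow> nat \<Rightarrow> complex" where
  "unit_vec j = (\<lambda>k. if k = j then 1 else 0)"

text \<open>Vectors of \<open>\<complex>\<^sup>m\<close> are functions of which only the values on \<open>{..<m}\<close> matter;
  \<open>jordan_block m z\<close> is the linear extension of its prescribed action on the unit vectors.\<close>

definition jordan_block :: "nat \<Rightarrow> complex \<Rightarrow> (nat \<Rightarrow> complex) \<Rightarrow> nat \<Rightarrow> complex" where
  "jordan_block m z v = (\<lambda>r. \<Sum>j<m. v j *
     (if j < m - 1 then z * unit_vec j r + (1 - (of_real (cmod z))\<^sup>2) * unit_vec (Suc j) r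
      else z * unit_vec j r))"

text \<open>Block \<open>i\<close> occupies the coordinates from \<open>offset n i\<close> up to, but excluding,
  \<open>offset n (Suc i)\<close>.\<close>

definition offset :: "(nat \<Rightarrow> nat) \<Rightarrow> nat \<Rightarrow> nat" where
  "offset n i = (\<Sum>l<i. n l)"

definition block_of :: "(nat \<Rightarrow> nat) \<Rightarrow> nat \<Rightarrow> nat" where
  "block_of n k = (LEAST i. k < offset n (Suc i))"

definition delta :: "(nat \<Rightarrow> nat) \<Rightarrow> nat \<Rightarrow> nat \<Rightarrow> nat \<Rightarrow> complex" where
  "delta n i j = unit_vec (j + offset n i)"

definition block_diag ::
  "(nat \<Rightarrow> nat) \<Rightarrow> (nat \<Rightarrow> (nat \<Rightarrow> complex) \<Rightarrow> nat \<Rightarrow> complex)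
    \<Rightarrow> (nat \<Rightarrow> complex) \<Rightarrow> nat \<Rightarrow> complex" where
  "block_diag n T f = (\<lambda>k. let i = block_of n k in
     T i (\<lambda>j. f (j + offset n i)) (k - offset n i))"

definition jordan_sum ::
  "(nat \<Rightarrow> nat) \<Rightarrow> (nat \<Rightarrow> complex) \<Rightarrow> (nat \<Rightarrow> complex) \<Rightarrow> nat \<Rightarrow> complex" where
  "jordan_sum n z = block_diag n (\<lambda>i. jordan_block (n i) (z i))"

lemma offset_mono: "i \<le> i' \<Longrightarrow> offset n i \<le> offset n i'"
  unfolding offset_def by (rule sum_mono2) auto

lemma block_of_offset:
  assumes "j < n i"
  shows "block_of n (j + offset n i) = i"
  unfolding block_of_def
proof (rule Least_equality)
  show "j + offset n i < offset n (Suc i)"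
    using assms by (simp add: offset_def)
next
  fix y assume "j + offset n i < offset n (Suc y)"
  then show "i \<le> y"
    using offset_mono[of "Suc y" i n] by (cases "i \<le> y") auto
qed

lemma offset_cases:
  assumes "\<And>i. 0 < n i"
  obtains i j where "j < n i" "k = j + offset n i"
proof -
  have "i \<le> offset n i" for i
  proof (induction i)
    case (Suc i)
    then show ?case using assms[of i] by (simp add: offset_def)
  qed simp
  then have ex: "k < offset n (Suc k)" by (meson Suc_le_lessD)
  define i where "i = (LEAST i. k < offset n (Suc i))"
  have 1: "k < offset n (Suc i)" unfolding i_def using ex by (rule LeastI)
  have 2: "offset n i \<le> k"
  proof (cases i)
    case 0
    then show ?thesis by (simp add: offset_def)
  next
    case (Suc m)
    then have "\<not> k < offset n (Suc m)"
      using not_less_Least[of m "\<lambda>i. k < offset n (Suc i)"] i_def by simp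
    then show ?thesis using Suc by simp
  qed
  show ?thesis
    by (rule that[of "k - offset n i" i]) (use 1 2 in \<open>auto simp: offset_def\<close>)
qed

lemma jordan_sum_delta:
  assumes pos: "\<And>i. 0 < n i" and j: "j < n i"
  shows "jordan_sum n z (delta n i j) =
    (if j < n i - 1
     then (\<lambda>k. z i * delta n i j k + (1 - (of_real (cmod (z i)))\<^sup>2) * delta n i (Suc j) k)
     else (\<lambda>k. z i * delta n i j k))" (is "?L = ?R")
proof
  fix k
  obtain i' r where r: "r < n i'" and k: "k = r + offset n i'"
    by (rule offset_cases[of n k, OF pos])
  have idx: "(s + offset n i' = t + offset n i) = (i' = i \<and> s = t)" if "s < n i'" "t < n i" for s t
    using block_of_offset[of s n i'] block_of_offset[of t n i] that by auto
  have d: "delta n i j (s + offset n i') = (if i' = i \<and> s = j then 1 else 0)" if "s < n i'" for s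
    unfolding delta_def unit_vec_def idx[OF that j] by simp
  have L: "?L k = (\<Sum>s<n i'. (if i' = i \<and> s = j then 1 else 0) *
     (if s < n i' - 1 then z i' * unit_vec s r + (1 - (of_real (cmod (z i')))\<^sup>2) * unit_vec (Suc s) r
      else z i' * unit_vec s r))"
    unfolding jordan_sum_def block_diag_def k block_of_offset[of r n i', OF r] jordan_block_def Let_def
      add_diff_cancel_right'
    by (rule sum.cong[OF refl]) (simp only: d lessThan_iff)
  show "?L k = ?R k"
  proof (cases "i' = i")
    case True
    have "?L k = (\<Sum>s<n i. if s = j then (if j < n i - 1 then
         z i * unit_vec j r + (1 - (of_real (cmod (z i)))\<^sup>2) * unit_vec (Suc j) r
         else z i * unit_vec j r) else 0)"
      unfolding L using True by (intro sum.cong) auto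
    then show ?thesis
      using j True by (cases "j < n i - 1") (simp_all add: k delta_def unit_vec_def)
  next
    case False
    then have "?L k = 0" unfolding L by simp
    moreover have "?R k = 0"
    proof (cases "j < n i - 1")
      case True
      then have "Suc j < n i" by simp
      then show ?thesis
        using True False idx[OF r j] idx[OF r \<open>Suc j < n i\<close>]
        by (simp add: k delta_def unit_vec_def)
    next
      case nl: False
      then show ?thesis
        using False idx[OF r j] by (simp add: k delta_def unit_vec_def)
    qed
    ultimately show ?thesis by simp
  qed
qed

subsection \<open>Carleson sequences\<close>

text \<open>The infinite product is the limit of its partial products, which decrease when \<open>z\<close> lies
  in the unit disc. This differs from \<open>prodinf\<close>, which is unspecified for a product of nonzero
  factors tending to zero.\<close>

definition carleson_sequence :: "(nat \<Rightarrow> complex) \<Rightarrow> bool" where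
  "carleson_sequence z \<longleftrightarrow> range z \<subseteq> ball 0 1 \<and>
     (INF k. lim (\<lambda>N. \<Prod>j\<in>{..<N} - {k}. cmod ((z j - z k) / (1 - cnj (z j) * z k)))) > 0"

end

theory Submission
  imports Defs "HOL-Complex_Analysis.Cauchy_Integral_Formula"
begin

text \<open>
  Conjugated coordinates of the orbit have generating functions in the Hardy space \<open>H\<^sup>2\<close> of the disc.
  Write \<open>b\<close> and \<open>k\<close> for the Blaschke factor and the normalised reproducing kernel at \<open>z i\<close>, and
  \<open>g = \<Sum> c i j sqrt (1 - \<bar>z i\<bar>\<^sup>2) \<delta> i j\<close>. Then the coordinate \<open>(i, r)\<close> of the orbit has the symbol
  \<open>\<Sum>\<^sub>s\<^sub>\<le>\<^sub>r cnj (c i s) (b + z i)\<^sup>r\<^sup>-\<^sup>s k\<close>, and by Parseval's identity (\<open>orbit_analysis_parseval\<close>) the orbit is a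
  frame if and only if the symbols of all coordinates form a Riesz sequence, that is, the norm of a finite
  combination is comparable with the \<open>\<ell>\<^sup>2\<close>-norm of its coefficients.

  If it does, single coordinates show that \<open>\<bar>z i\<bar> < 1\<close> and that \<open>c\<close> is bounded, and bounded below at
  \<open>j = 0\<close>. The symbols with \<open>r = 0\<close> are multiples of the kernels, so the kernels form a Riesz sequence.
  The product of the kernel at \<open>z i\<close> with the Blaschke product \<open>B\<close> of other points has norm one and is a
  combination of kernels whose coefficient at \<open>i\<close> has modulus \<open>1 / \<bar>B (z i)\<bar>\<close>; the lower Riesz bound
  is thus a lower bound for \<open>\<bar>B (z i)\<bar>\<close>, which is Carleson's condition (\<open>szego_riesz_imp_separated\<close>).

  For the converse, the functions \<open>b\<^sup>t k\<close> with \<open>t < m\<close> are orthonormal for fixed \<open>i\<close>, and the symbols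
  of the block arise from them by a triangular matrix with diagonal \<open>cnj (c i 0)\<close>, which is uniformly
  invertible. It remains to see that, for vectors taken from the spaces spanned by these families for
  different \<open>i\<close>, the squared norm of the sum is comparable with the sum of the squared norms
  (\<open>blaschke_blocks_riesz\<close>). For any signs \<open>\<epsilon> i\<close> there is a bounded
  analytic function equal to \<open>\<epsilon> i\<close> at \<open>z i\<close> to order \<open>m\<close>; it is built from the explicit
  functions of P. Jones (\<open>jones_functions\<close>), for which the bound is elementary. The adjoint
  of multiplication by this function multiplies the component in the space of \<open>z i\<close> by \<open>\<epsilon> i\<close>. Changes of signs
  are therefore uniformly bounded, while the average of the squared norm over all signs is exactly the
  sum of the squared norms. These estimates are uniform in the number of blocks, and
  a limit extends them from finitely supported vectors to the whole space.
\<close>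

section \<open>Means over the unit circle\<close>

text \<open>The normalised integral over the unit circle, parametrised over \<open>{0..1}\<close> as \<open>circlepath\<close> is, so
  that no factor \<open>2\<pi>\<close> appears and real and complex integrands are treated alike.\<close>

definition circle_mean :: "(complex \<Rightarrow> 'a::euclidean_space) \<Rightarrow> 'a" where
  "circle_mean f = integral {0..1} (\<lambda>t. f (cis (2 * pi * t)))"

text \<open>The squared norm of \<open>L\<^sup>2\<close> of the circle; for a power series it is the squared norm in
  the Hardy space \<open>H\<^sup>2\<close>.\<close>

definition circle_sq :: "(complex \<Rightarrow> complex) \<Rightarrow> real" where
  "circle_sq f = circle_mean (\<lambda>w. (cmod (f w))\<^sup>2)"

lemma circle_integrable:
  fixes f :: "complex \<Rightarrow> 'a::euclidean_space"
  assumes "continuous_on (sphere 0 1) f"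
  shows "(\<lambda>t. f (cis (2 * pi * t))) integrable_on {0..1}"
proof (rule integrable_continuous_interval)
  have "continuous_on {0..1} (f \<circ> (\<lambda>t. cis (2 * pi * t)))"
    by (intro continuous_on_compose continuous_intros continuous_on_subset[OF assms]) auto
  then show "continuous_on {0..1} (\<lambda>t. f (cis (2 * pi * t)))" by (simp add: o_def)
qed

lemma circle_mean_cong:
  assumes "\<And>w. cmod w = 1 \<Longrightarrow> f w = g w"
  shows "circle_mean f = circle_mean g"
  unfolding circle_mean_def using assms by simp

lemma circle_mean_add:
  assumes "continuous_on (sphere 0 1) f" "continuous_on (sphere 0 1) g"
  shows "circle_mean (\<lambda>w. f w + g w) = circle_mean f + circle_mean g"
  unfolding circle_mean_def
  using circle_integrable[OF assms(1)] circle_integrable[OF assms(2)] by (rule integral_add)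

lemma circle_mean_diff:
  assumes "continuous_on (sphere 0 1) f" "continuous_on (sphere 0 1) g"
  shows "circle_mean (\<lambda>w. f w - g w) = circle_mean f - circle_mean g"
  unfolding circle_mean_def
  using circle_integrable[OF assms(1)] circle_integrable[OF assms(2)] by (rule integral_diff)

lemma circle_mean_const: "circle_mean (\<lambda>w. c) = c"
  unfolding circle_mean_def by simp

lemma circle_mean_cmult:
  fixes f :: "complex \<Rightarrow> 'a::{real_normed_field, euclidean_space}"
  shows "circle_mean (\<lambda>w. c * f w) = c * circle_mean f"
  unfolding circle_mean_def by (rule integral_mult_right)

lemma circle_mean_sum:
  assumes "finite S" "\<And>i. i \<in> S \<Longrightarrow> continuous_on (sphere 0 1) (f i)"
  shows "circle_mean (\<lambda>w. \<Sum>i\<in>S. f i w) = (\<Sum>i\<in>S. circle_mean (f i))"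
  unfolding circle_mean_def using assms circle_integrable by (intro integral_sum) auto

lemma circle_mean_cnj: "circle_mean (\<lambda>w. cnj (f w)) = cnj (circle_mean f)"
  unfolding circle_mean_def using integral_cnj[of "{0..1}" "\<lambda>t. f (cis (2 * pi * t))"] by simp

lemma circle_mean_mono:
  fixes f g :: "complex \<Rightarrow> real"
  assumes "continuous_on (sphere 0 1) f" "continuous_on (sphere 0 1) g"
    "\<And>w. cmod w = 1 \<Longrightarrow> f w \<le> g w"
  shows "circle_mean f \<le> circle_mean g"
  unfolding circle_mean_def
  by (rule integral_le[OF circle_integrable[OF assms(1)] circle_integrable[OF assms(2)]])
     (simp add: assms(3))

lemma circle_mean_norm_le:
  fixes f :: "complex \<Rightarrow> complex"
  assumes "continuous_on (sphere 0 1) f" "continuous_on (sphere 0 1) g"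
    "\<And>w. cmod w = 1 \<Longrightarrow> cmod (f w) \<le> g w"
  shows "cmod (circle_mean f) \<le> circle_mean g"
  unfolding circle_mean_def
  by (rule integral_norm_bound_integral[OF circle_integrable[OF assms(1)] circle_integrable[OF assms(2)]])
     (simp add: assms(3))

lemma circle_mean_of_real:
  assumes "continuous_on (sphere 0 1) f"
  shows "circle_mean (\<lambda>w. complex_of_real (f w)) = of_real (circle_mean f)"
proof -
  have "((\<lambda>t. f (cis (2 * pi * t))) has_integral circle_mean f) {0..1}"
    unfolding circle_mean_def using circle_integrable[OF assms] by (rule integrable_integral)
  then have "((\<lambda>t. complex_of_real (f (cis (2 * pi * t)))) has_integral of_real (circle_mean f)) {0..1}"
    using has_integral_linear[OF _ bounded_linear_of_real, of "\<lambda>t. f (cis (2 * pi * t))"]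
    unfolding o_def by blast
  then show ?thesis unfolding circle_mean_def by (rule integral_unique)
qed

lemma analytic_continuous_circle:
  assumes "f analytic_on cball 0 1"
  shows "continuous_on (sphere 0 1) f"
  using analytic_imp_holomorphic[OF assms]
  by (meson continuous_on_subset holomorphic_on_imp_continuous_on sphere_cball)

text \<open>Cauchy's formula at the centre. It is the only fact about holomorphic functions from which
  the orthogonality relations below are derived.\<close>

lemma circle_mean_analytic:
  assumes "f analytic_on cball 0 1"
  shows "circle_mean f = f 0"
proof -
  have "((\<lambda>u. f u / (u - 0)) has_contour_integral (2 * of_real pi * \<i> * f 0)) (circlepath 0 1)"
    by (rule Cauchy_integral_circlepath_simple[OF analytic_imp_holomorphic[OF assms]]) simp
  then have "((\<lambda>t. f (circlepath 0 1 t) / circlepath 0 1 t *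
       vector_derivative (circlepath 0 1) (at t)) has_integral (2 * of_real pi * \<i> * f 0)) {0..1}"
    by (simp add: has_contour_integral)
  then have "((\<lambda>t. (2 * of_real pi * \<i>) * f (cis (2 * pi * t))) has_integral (2 * of_real pi * \<i> * f 0)) {0..1}"
  proof (rule has_integral_eq[rotated])
    fix t :: real
    have e: "exp (2 * of_real pi * \<i> * of_real t) = cis (2 * pi * t)"
      by (simp add: cis_conv_exp mult_ac)
    show "f (circlepath 0 1 t) / circlepath 0 1 t * vector_derivative (circlepath 0 1) (at t)
        = (2 * of_real pi * \<i>) * f (cis (2 * pi * t))"
      unfolding vector_derivative_circlepath unfolding circlepath e by simp
  qed
  then have "((\<lambda>t. (1 / (2 * of_real pi * \<i>)) * ((2 * of_real pi * \<i>) * f (cis (2 * pi * t))))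
      has_integral (1 / (2 * of_real pi * \<i>)) * (2 * of_real pi * \<i> * f 0)) {0..1}"
    by (rule has_integral_mult_right)
  then show ?thesis unfolding circle_mean_def by (simp add: integral_unique)
qed

lemma continuous_circle_sq:
  assumes "continuous_on (sphere 0 1) f"
  shows "continuous_on (sphere 0 1) (\<lambda>w. (cmod (f w))\<^sup>2)"
  by (intro continuous_intros assms)

lemma circle_sq_nonneg: 
  assumes "continuous_on (sphere 0 1) f"
  shows "0 \<le> circle_sq f"
  using circle_mean_mono[of "\<lambda>w. 0", OF _ continuous_circle_sq[OF assms]]
  by (simp add: circle_sq_def circle_mean_const)

lemma circle_sq_cmult: "circle_sq (\<lambda>w. c * f w) = (cmod c)\<^sup>2 * circle_sq f"
  unfolding circle_sq_def by (simp add: norm_mult power_mult_distrib circle_mean_cmult)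

lemma circle_sq_cong:
  assumes "\<And>w. cmod w = 1 \<Longrightarrow> cmod (f w) = cmod (g w)"
  shows "circle_sq f = circle_sq g"
  unfolding circle_sq_def by (rule circle_mean_cong) (simp add: assms)

lemma of_real_circle_sq:
  assumes "continuous_on (sphere 0 1) f"
  shows "of_real (circle_sq f) = circle_mean (\<lambda>w. f w * cnj (f w))"
  unfolding circle_sq_def circle_mean_of_real[OF continuous_circle_sq[OF assms], symmetric]
  by (rule circle_mean_cong) (simp only: complex_norm_square)

lemma circle_sq_parallelogram:
  assumes "continuous_on (sphere 0 1) f" "continuous_on (sphere 0 1) g"
  shows "circle_sq (\<lambda>w. f w + g w) + circle_sq (\<lambda>w. f w - g w) = 2 * circle_sq f + 2 * circle_sq g"
proof -
  have "circle_sq (\<lambda>w. f w + g w) + circle_sq (\<lambda>w. f w - g w)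
    = circle_mean (\<lambda>w. (cmod (f w + g w))\<^sup>2 + (cmod (f w - g w))\<^sup>2)"
    unfolding circle_sq_def using assms by (intro circle_mean_add[symmetric] continuous_intros)
  also have "\<dots> = circle_mean (\<lambda>w. 2 * (cmod (f w))\<^sup>2 + 2 * (cmod (g w))\<^sup>2)"
    by (intro circle_mean_cong) (simp add: cmod_power2, simp add: power2_eq_square algebra_simps)
  also have "\<dots> = 2 * circle_sq f + 2 * circle_sq g"
    unfolding circle_sq_def using assms
    by (subst circle_mean_add) (auto intro!: continuous_intros simp: circle_mean_cmult)
  finally show ?thesis .
qed

lemma circle_sq_add_le:
  assumes "continuous_on (sphere 0 1) f" "continuous_on (sphere 0 1) g"
  shows "circle_sq (\<lambda>w. f w + g w) \<le> 2 * circle_sq f + 2 * circle_sq g"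
  using circle_sq_parallelogram[OF assms] circle_sq_nonneg[OF continuous_on_diff[OF assms]] by simp

lemma circle_mean_monomials:
  "circle_mean (\<lambda>w. w ^ k * cnj (w ^ l)) = (if k = l then 1 else 0)"
proof -
  have le: "circle_mean (\<lambda>w. w ^ k * cnj (w ^ l)) = (if k = l then 1 else 0)" if "l \<le> k" for k l
  proof -
    have "circle_mean (\<lambda>w. w ^ k * cnj (w ^ l)) = circle_mean (\<lambda>w. w ^ (k - l))"
    proof (rule circle_mean_cong)
      fix w :: complex assume "cmod w = 1"
      then have "w * cnj w = 1" by (simp add: complex_norm_square[symmetric])
      then have "w ^ l * cnj w ^ l = 1" by (metis power_mult_distrib power_one)
      moreover have "w ^ k = w ^ (k - l) * w ^ l" using that by (simp add: power_add[symmetric])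
      ultimately show "w ^ k * cnj (w ^ l) = w ^ (k - l)" by (simp add: mult.assoc)
    qed
    also have "\<dots> = 0 ^ (k - l)" by (intro circle_mean_analytic analytic_intros)
    also have "\<dots> = (if k = l then 1 else 0)" using that by auto
    finally show ?thesis .
  qed
  show ?thesis
  proof (cases "l \<le> k")
    case False
    have "circle_mean (\<lambda>w. w ^ k * cnj (w ^ l)) = cnj (circle_mean (\<lambda>w. w ^ l * cnj (w ^ k)))"
      by (subst circle_mean_cnj[symmetric]) (simp add: mult.commute)
    then show ?thesis using le[of k l] False by (simp add: le)
  qed (use le in blast)
qed

text \<open>Absolutely summable coefficients make the convergence uniform on the circle, which is
  what permits termwise integration.\<close>

lemma continuous_circle_power_series:
  fixes a :: "nat \<Rightarrow> complex"
  assumes a: "summable (\<lambda>k. cmod (a k))"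
    and F: "\<And>w. cmod w = 1 \<Longrightarrow> (\<lambda>k. a k * w ^ k) sums F w"
  shows "uniform_limit (sphere 0 1) (\<lambda>N w. \<Sum>k<N. a k * w ^ k) F sequentially"
    and "continuous_on (sphere 0 1) F"
proof -
  have "uniform_limit (sphere 0 1) (\<lambda>N w. \<Sum>k<N. a k * w ^ k) (\<lambda>w. \<Sum>k. a k * w ^ k) sequentially"
    by (rule Weierstrass_m_test[OF _ a]) (auto simp: norm_mult norm_power)
  then show u: "uniform_limit (sphere 0 1) (\<lambda>N w. \<Sum>k<N. a k * w ^ k) F sequentially"
    by (rule uniform_limit_cong'[THEN iffD1, rotated 2]) (auto dest!: F sums_unique)
  show "continuous_on (sphere 0 1) F"
    by (rule uniform_limit_theorem[OF _ u]) (auto intro!: continuous_intros always_eventually)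
qed

text \<open>The identity is the orthonormality of the monomials for polynomials; it passes to the limit
  because the partial sums, and hence their squared moduli, converge uniformly on the circle.\<close>

lemma parseval_circle:
  fixes a :: "nat \<Rightarrow> complex"
  assumes a: "summable (\<lambda>k. cmod (a k))"
    and F: "\<And>w. cmod w = 1 \<Longrightarrow> (\<lambda>k. a k * w ^ k) sums F w"
  shows "(\<lambda>k. (cmod (a k))\<^sup>2) sums circle_sq F"
proof -
  define P where "P N w = (\<Sum>k<N. a k * w ^ k)" for N w
  note u = continuous_circle_power_series(1)[OF a F] 
  have contP: "continuous_on (sphere 0 1) (P N)" for N
    unfolding P_def by (intro continuous_intros)
  have sqP: "circle_sq (P N) = (\<Sum>k<N. (cmod (a k))\<^sup>2)" for N
  proof -
    have "of_real (circle_sq (P N)) = circle_mean (\<lambda>w. \<Sum>k<N. \<Sum>l<N. (a k * cnj (a l)) * (w ^ k * cnj (w ^ l)))"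
      unfolding of_real_circle_sq[OF contP] 
      by (simp add: P_def sum_product mult_ac)
    also have "\<dots> = (\<Sum>k<N. \<Sum>l<N. (a k * cnj (a l)) * circle_mean (\<lambda>w. w ^ k * cnj (w ^ l)))"
      by (subst circle_mean_sum, force, (intro continuous_intros; fail),
          subst circle_mean_sum, force, (intro continuous_intros; fail), simp only: circle_mean_cmult)
    also have "\<dots> = (\<Sum>k<N. a k * cnj (a k))"
      by (simp only: circle_mean_monomials) (simp add: if_distrib[of "\<lambda>x. _ * x"] cong: if_cong)
    also have "\<dots> = of_real (\<Sum>k<N. (cmod (a k))\<^sup>2)"
      by (simp only: of_real_sum complex_norm_square)
    finally show ?thesis by (simp only: of_real_eq_iff)
  qed
  have "uniform_limit {0..1} (\<lambda>N t. (cmod (P N (cis (2 * pi * t))))\<^sup>2) (\<lambda>t. (cmod (F (cis (2 * pi * t))))\<^sup>2) sequentially"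
  proof -
    have b: "bounded (F ` sphere 0 1)"
      by (rule compact_imp_bounded[OF compact_continuous_image[OF continuous_circle_power_series(2)[OF a F]]]) auto
    have uP: "uniform_limit (sphere 0 1) P F sequentially" using u by (simp add: P_def[abs_def])
    have un: "uniform_limit (sphere 0 1) (\<lambda>N w. cmod (P N w)) (\<lambda>w. cmod (F w)) sequentially"
      by (intro uniform_limit_intros uP)
    have bn: "bounded ((\<lambda>w. cmod (F w)) ` sphere 0 1)"
      using b by (auto simp: bounded_iff)
    have "uniform_limit (sphere 0 1) (\<lambda>N w. cmod (P N w) * cmod (P N w)) (\<lambda>w. cmod (F w) * cmod (F w)) sequentially"
      by (rule uniform_lim_mult[OF un un bn bn])
    then have "uniform_limit (sphere 0 1) (\<lambda>N w. (cmod (P N w))\<^sup>2) (\<lambda>w. (cmod (F w))\<^sup>2) sequentially"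
      by (simp add: power2_eq_square)
    from uniform_limit_compose'[OF this, of "\<lambda>t. cis (2 * pi * t)" "{0..1}"]
    show ?thesis by auto
  qed
  moreover have "continuous_on {0..1} (\<lambda>t. (cmod (P N (cis (2 * pi * t))))\<^sup>2)" for N
    unfolding P_def by (intro continuous_intros)
  ultimately obtain I J where
    I: "\<And>N. ((\<lambda>t. (cmod (P N (cis (2 * pi * t))))\<^sup>2) has_integral I N) {0..1}"
    and J: "((\<lambda>t. (cmod (F (cis (2 * pi * t))))\<^sup>2) has_integral J) {0..1}"
    and IJ: "I \<longlonglongrightarrow> J"
    by (rule uniform_limit_integral[OF _ _ sequentially_bot]) (rule that, assumption+)
  have "circle_sq (P N) = I N" for N
    using integral_unique[OF I] by (simp add: circle_sq_def circle_mean_def)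
  moreover have "circle_sq F = J"
    using integral_unique[OF J] by (simp add: circle_sq_def circle_mean_def)
  ultimately have "(\<lambda>N. circle_sq (P N)) \<longlonglongrightarrow> circle_sq F"
    using IJ by simp
  then show ?thesis by (simp add: sqP sums_def)
qed

section \<open>Blaschke factors and Szego kernels\<close>

definition blaschke :: "complex \<Rightarrow> complex \<Rightarrow> complex" where
  "blaschke a w = (w - a) / (1 - cnj a * w)"

text \<open>The reproducing kernel of \<open>H\<^sup>2\<close> at \<open>a\<close>, normalised to have norm one.\<close>

definition szego :: "complex \<Rightarrow> complex \<Rightarrow> complex" where
  "szego a w = of_real (sqrt (1 - (cmod a)\<^sup>2)) / (1 - cnj a * w)"

lemma one_minus_cnj_mult_nonzero:
  assumes "cmod a < 1" "cmod w \<le> 1"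
  shows "1 - cnj a * w \<noteq> 0"
proof
  assume "1 - cnj a * w = 0"
  then have "cmod a * cmod w = 1" by (metis complex_mod_cnj eq_iff_diff_eq_0 norm_mult norm_one)
  moreover have "cmod a * cmod w \<le> cmod a * 1" using assms by (intro mult_left_mono) auto
  ultimately show False using assms by simp
qed

lemma cnj_mult_neq_one: "cmod a < 1 \<Longrightarrow> cmod w \<le> 1 \<Longrightarrow> cnj a * w \<noteq> 1"
  using one_minus_cnj_mult_nonzero by fastforce

lemma one_minus_cmod_sq_pos: "cmod a < 1 \<Longrightarrow> 0 < 1 - (cmod a)\<^sup>2"
  by (simp add: power_less_one_iff)

lemma analytic_blaschke: "cmod a < 1 \<Longrightarrow> blaschke a analytic_on cball 0 1"
  unfolding blaschke_def[abs_def] by (intro analytic_intros) (auto simp: cnj_mult_neq_one)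

lemma analytic_szego: "cmod a < 1 \<Longrightarrow> szego a analytic_on cball 0 1"
  unfolding szego_def[abs_def] by (intro analytic_intros) (auto simp: cnj_mult_neq_one)

lemma mult_cnj_circle: "cmod w = 1 \<Longrightarrow> w * cnj w = 1"
  by (simp add: complex_norm_square[symmetric])

text \<open>On the circle conjugation is inversion, so conjugating the denominator of a Blaschke factor
  gives its numerator up to the unimodular factor \<open>w\<close>.\<close>

lemma one_minus_cnj_circle:
  assumes "cmod w = 1"
  shows "w * cnj (1 - cnj a * w) = w - a"
  using mult_cnj_circle[OF assms] by (simp add: algebra_simps)

lemma cmod_one_minus_cnj_circle:
  assumes "cmod w = 1"
  shows "cmod (1 - cnj a * w) = cmod (w - a)"
  using assms one_minus_cnj_circle[OF assms, of a, symmetric] by (simp only: norm_mult complex_mod_cnj)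

lemma cmod_blaschke_circle:
  assumes "cmod a < 1" "cmod w = 1"
  shows "cmod (blaschke a w) = 1"
  using one_minus_cnj_mult_nonzero[of a w] assms cmod_one_minus_cnj_circle[OF assms(2), of a, symmetric]
  by (simp add: blaschke_def norm_divide)

text \<open>The defect of a Blaschke factor is symmetric in its two points; this links the size of
  \<open>\<Prod>\<bar>b\<bar>\<close> in Carleson's condition with Poisson kernels.\<close>

lemma blaschke_defect:
  assumes "cmod a < 1" "cmod w \<le> 1"
  shows "1 - (cmod (blaschke a w))\<^sup>2
    = (1 - (cmod a)\<^sup>2) * (1 - (cmod w)\<^sup>2) / (cmod (1 - cnj a * w))\<^sup>2"
proof -
  have nz: "(cmod (1 - cnj a * w))\<^sup>2 \<noteq> 0" using one_minus_cnj_mult_nonzero[OF assms] by simp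
  have "(cmod (1 - cnj a * w))\<^sup>2 - (cmod (w - a))\<^sup>2 = (1 - (cmod a)\<^sup>2) * (1 - (cmod w)\<^sup>2)"
    by (simp add: cmod_power2, simp add: power2_eq_square algebra_simps)
  then show ?thesis using nz
    by (simp add: blaschke_def norm_divide power_divide diff_divide_distrib[symmetric] field_simps)
qed

text \<open>The kernel at \<open>a\<close> is orthogonal to every analytic function vanishing at \<open>a\<close>: on the circle
  the conjugated integrand is \<open>w\<close> times an analytic function, and has mean zero.\<close>

lemma mean_szego_blaschke:
  assumes a: "cmod a < 1" and h: "h analytic_on cball 0 1"
  shows "circle_mean (\<lambda>w. szego a w * cnj (blaschke a w * h w)) = 0"
proof -
  define s where "s = complex_of_real (sqrt (1 - (cmod a)\<^sup>2))"
  have "circle_mean (\<lambda>w. szego a w * cnj (blaschke a w * h w))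
      = cnj (circle_mean (\<lambda>w. cnj (szego a w) * (blaschke a w * h w)))"
    by (subst circle_mean_cnj[symmetric]) simp
  also have "circle_mean (\<lambda>w. cnj (szego a w) * (blaschke a w * h w))
     = circle_mean (\<lambda>w. w * (s / (1 - cnj a * w) * h w))"
  proof (rule circle_mean_cong)
    fix w :: complex assume w: "cmod w = 1"
    have nz: "1 - cnj a * w \<noteq> 0" using one_minus_cnj_mult_nonzero a w by simp
    then have "cnj (1 - cnj a * w) \<noteq> 0" by (simp only: complex_cnj_zero_iff not_False_eq_True)
    then have "cnj (szego a w) * (w - a) = w * s"
      unfolding one_minus_cnj_circle[OF w, of a, symmetric] szego_def s_def[symmetric] complex_cnj_divide
      by (simp add: s_def)
    then have "cnj (szego a w) * (w - a) * (h w / (1 - cnj a * w)) = w * s * (h w / (1 - cnj a * w))"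
      by (rule arg_cong)
    then show "cnj (szego a w) * (blaschke a w * h w) = w * (s / (1 - cnj a * w) * h w)"
      unfolding blaschke_def by simp
  qed
  also have "\<dots> = 0"
    by (subst circle_mean_analytic) (auto intro!: analytic_intros h simp: cnj_mult_neq_one a)
  finally show ?thesis by simp
qed

text \<open>The squared modulus of the kernel is the Poisson kernel, which on the circle is
  \<open>s + cnj s - 1\<close> for an analytic \<open>s\<close> with \<open>s 0 = 1\<close>.\<close>

lemma circle_sq_szego:
  assumes a: "cmod a < 1"
  shows "circle_sq (szego a) = 1"
proof -
  define s where "s = (\<lambda>w. 1 / (1 - cnj a * w))"
  have ans: "s analytic_on cball 0 1"
    unfolding s_def by (intro analytic_intros) (auto simp: cnj_mult_neq_one a)
  note cs = analytic_continuous_circle[OF ans]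
  have "of_real (circle_sq (szego a)) = circle_mean (\<lambda>w. szego a w * cnj (szego a w))"
    by (intro of_real_circle_sq analytic_continuous_circle analytic_szego a)
  also have "\<dots> = circle_mean (\<lambda>w. (s w + cnj (s w)) - 1)"
  proof (rule circle_mean_cong)
    fix w :: complex assume w: "cmod w = 1"
    define u where "u = 1 - cnj a * w"
    have "u \<noteq> 0" using one_minus_cnj_mult_nonzero[OF a, of w] w by (simp add: u_def)
    then have nz: "u \<noteq> 0" "cnj u \<noteq> 0" by simp_all
    have q: "complex_of_real (sqrt (1 - (cmod a)\<^sup>2)) * of_real (sqrt (1 - (cmod a)\<^sup>2)) = 1 - a * cnj a"
      using one_minus_cmod_sq_pos[OF a]
      by (simp flip: of_real_mult complex_norm_square of_real_power)
    have "w * cnj w = 1" using mult_cnj_circle[OF w] .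
    then have uu: "u + cnj u - u * cnj u = 1 - a * cnj a"
      by (simp add: u_def algebra_simps)
    have "szego a w * cnj (szego a w) = (1 - a * cnj a) / (u * cnj u)"
      unfolding szego_def u_def[symmetric] complex_cnj_divide complex_cnj_complex_of_real times_divide_times_eq q ..
    also have "\<dots> = (1 / u + 1 / cnj u) - 1" unfolding uu[symmetric] using nz by (simp add: field_simps)
    finally show "szego a w * cnj (szego a w) = (s w + cnj (s w)) - 1"
      unfolding s_def u_def[symmetric] by simp
  qed
  also have "\<dots> = (circle_mean s + cnj (circle_mean s)) - 1"
    using cs by (simp add: circle_mean_diff circle_mean_add continuous_intros circle_mean_cnj circle_mean_const)
  also have "\<dots> = 1" unfolding circle_mean_analytic[OF ans] by (simp add: s_def)
  finally show ?thesis by (metis of_real_1 of_real_eq_iff)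
qed

text \<open>The space spanned by \<open>b\<^sup>t k\<close> for \<open>t < m\<close> is the orthogonal complement of \<open>b\<^sup>m H\<^sup>2\<close>, where
  \<open>b\<close> and \<open>k\<close> are the Blaschke factor and the kernel at \<open>a\<close>. Cancelling \<open>b\<^sup>t\<close>, which is unimodular on
  the circle, leaves the case of the kernel itself.\<close>

lemma mean_block_annihilates:
  assumes a: "cmod a < 1" and h: "h analytic_on cball 0 1" and "t < m"
  shows "circle_mean (\<lambda>w. (blaschke a w ^ t * szego a w) * cnj (blaschke a w ^ m * h w)) = 0"
proof -
  have "circle_mean (\<lambda>w. (blaschke a w ^ t * szego a w) * cnj (blaschke a w ^ m * h w))
    = circle_mean (\<lambda>w. szego a w * cnj (blaschke a w * (blaschke a w ^ (m - t - 1) * h w)))"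
  proof (rule circle_mean_cong)
    fix w :: complex assume w: "cmod w = 1"
    have "blaschke a w * cnj (blaschke a w) = 1"
      by (intro mult_cnj_circle cmod_blaschke_circle a w)
    then have 1: "blaschke a w ^ t * cnj (blaschke a w) ^ t = 1" by (metis power_mult_distrib power_one)
    have "m = t + (1 + (m - t - 1))" using assms(3) by simp
    then have 2: "cnj (blaschke a w) ^ m = cnj (blaschke a w) ^ t * (cnj (blaschke a w) * cnj (blaschke a w) ^ (m - t - 1))"
      by (metis power_add power_one_right)
    show "(blaschke a w ^ t * szego a w) * cnj (blaschke a w ^ m * h w) = szego a w * cnj (blaschke a w * (blaschke a w ^ (m - t - 1) * h w))"
      using 1 by (simp add: 2)
  qed
  also have "\<dots> = 0"
    by (intro mean_szego_blaschke a analytic_intros analytic_blaschke h)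
  finally show ?thesis .
qed

text \<open>The functions \<open>b\<^sup>t k\<close> are orthonormal: distinct ones are orthogonal by
  \<open>mean_block_annihilates\<close>, and the factors \<open>b\<^sup>t\<close> are unimodular on the circle.\<close>

lemma circle_sq_block:
  assumes a: "cmod a < 1"
  shows "circle_sq (\<lambda>w. \<Sum>t<m. d t * (blaschke a w ^ t * szego a w)) = (\<Sum>t<m. (cmod (d t))\<^sup>2)"
proof -
  let ?e = "\<lambda>t w. blaschke a w ^ t * szego a w"
  have ane: "?e t analytic_on cball 0 1" for t
    by (intro analytic_intros analytic_blaschke analytic_szego a)
  note ce = analytic_continuous_circle[OF ane]
  have ort: "circle_mean (\<lambda>w. ?e s w * cnj (?e t w)) = (if s = t then 1 else 0)" for s t
  proof -
    have lt: "circle_mean (\<lambda>w. ?e s w * cnj (?e t w)) = 0" if "s < t" for s t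
      by (rule mean_block_annihilates[OF a analytic_szego[OF a] that])
    consider "s < t" | "s = t" | "t < s" by linarith
    then show ?thesis
    proof cases
      case 2
      have "of_real (circle_sq (?e t)) = circle_mean (\<lambda>w. ?e t w * cnj (?e t w))"
        by (rule of_real_circle_sq[OF ce])
      moreover have "circle_sq (?e t) = circle_sq (szego a)"
        by (rule circle_sq_cong) (simp add: norm_mult norm_power cmod_blaschke_circle a)
      ultimately show ?thesis using 2 circle_sq_szego[OF a] by simp
    next
      case 3
      have "circle_mean (\<lambda>w. ?e s w * cnj (?e t w)) = cnj (circle_mean (\<lambda>w. ?e t w * cnj (?e s w)))"
        by (subst circle_mean_cnj[symmetric]) (simp add: mult.commute)
      then show ?thesis using 3 by (simp only: lt[OF 3]) simp
    qed (use lt[of s t] in simp)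
  qed
  have "of_real (circle_sq (\<lambda>w. \<Sum>t<m. d t * ?e t w))
      = circle_mean (\<lambda>w. (\<Sum>t<m. d t * ?e t w) * cnj (\<Sum>t<m. d t * ?e t w))"
    by (intro of_real_circle_sq continuous_intros ce)
  also have "\<dots> = circle_mean (\<lambda>w. \<Sum>s<m. \<Sum>t<m. (d s * cnj (d t)) * (?e s w * cnj (?e t w)))"
    by (simp add: sum_product mult_ac)
  also have "\<dots> = (\<Sum>s<m. \<Sum>t<m. (d s * cnj (d t)) * circle_mean (\<lambda>w. ?e s w * cnj (?e t w)))"
    by (subst circle_mean_sum, force, (intro continuous_intros ce; fail),
        subst circle_mean_sum, force, (intro continuous_intros ce; fail), simp only: circle_mean_cmult)
  also have "\<dots> = (\<Sum>t<m. d t * cnj (d t))"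
    by (simp only: ort) (simp add: if_distrib[of "\<lambda>x. _ * x"] cong: if_cong)
  also have "\<dots> = of_real (\<Sum>t<m. (cmod (d t))\<^sup>2)" by (simp only: of_real_sum complex_norm_square)
  finally show ?thesis by (simp only: of_real_eq_iff)
qed

text \<open>The quotient of \<open>f\<close> by \<open>w - a\<close> has a removable singularity at \<open>a\<close>.\<close>

lemma analytic_divide_blaschke:
  assumes a: "cmod a < 1" and f: "f analytic_on cball 0 1" and "f a = 0"
  obtains r where "r analytic_on cball 0 1" "\<And>w. cmod w \<le> 1 \<Longrightarrow> f w = blaschke a w * r w"
proof -
  obtain T where T: "open T" "cball 0 1 \<subseteq> T" "f holomorphic_on T"
    using f unfolding analytic_on_holomorphic by blast
  define F where "F = (\<lambda>w. if w = a then deriv f a else (f w - f a) / (w - a))"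
  have "F holomorphic_on T" unfolding F_def by (rule pole_lemma_open[OF T(3,1)])
  then have "F analytic_on cball 0 1" unfolding analytic_on_holomorphic using T by blast
  then have "(\<lambda>w. (1 - cnj a * w) * F w) analytic_on cball 0 1" by (intro analytic_intros)
  moreover have "f w = blaschke a w * ((1 - cnj a * w) * F w)" if "cmod w \<le> 1" for w
    using one_minus_cnj_mult_nonzero[OF a that] assms(3) by (simp add: blaschke_def F_def)
  ultimately show ?thesis by (rule that)
qed

section \<open>Interpolating functions of Jones\<close>

text \<open>A discrete form of \<open>\<integral> a(t) exp (- \<integral>\<^sub>t a) dt \<le> 1\<close>: each weight \<open>a j\<close> is damped by the
  exponential of the total weight of the indices ranked at least as high as \<open>j\<close>. Adding an element
  \<open>x\<close> of lowest rank can only decrease the other terms, so the induction step reduces to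
  \<open>(1 + a x) exp (- a x) \<le> 1\<close>.\<close>

lemma sum_mult_exp_ranked_le:
  fixes a \<rho> :: "'i \<Rightarrow> real"
  assumes "finite S" and a: "\<And>i. 0 \<le> a i"
  shows "(\<Sum>j\<in>S. a j * exp (- (\<Sum>k\<in>{k\<in>S. \<rho> j \<le> \<rho> k}. a k))) \<le> 1 - exp (- (\<Sum>k\<in>S. a k))"
  using assms(1)
proof (induction S rule: finite_ranking_induct[where f = "\<lambda>i. - \<rho> i"])
  case (insert x S)
  show ?case
  proof (cases "x \<in> S")
    case True
    then show ?thesis using insert.IH by (simp add: insert_absorb)
  next
    case False
    define A where "A = (\<Sum>k\<in>S. a k)"
    let ?L = "\<lambda>S j. a j * exp (- (\<Sum>k\<in>{k\<in>S. \<rho> j \<le> \<rho> k}. a k))"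
    have "{k \<in> insert x S. \<rho> x \<le> \<rho> k} = insert x S" using insert.hyps by fastforce
    then have x: "?L (insert x S) x = a x * exp (- (a x + A))"
      using False insert.hyps by (simp add: A_def)
    have "(\<Sum>j\<in>S. ?L (insert x S) j) \<le> (\<Sum>j\<in>S. ?L S j)"
    proof (intro sum_mono mult_left_mono a)
      fix j
      have "(\<Sum>k\<in>{k\<in>S. \<rho> j \<le> \<rho> k}. a k) \<le> (\<Sum>k\<in>{k\<in>insert x S. \<rho> j \<le> \<rho> k}. a k)"
        using insert.hyps a by (intro sum_mono2) auto
      then show "exp (- (\<Sum>k\<in>{k\<in>insert x S. \<rho> j \<le> \<rho> k}. a k)) \<le> exp (- (\<Sum>k\<in>{k\<in>S. \<rho> j \<le> \<rho> k}. a k))"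
        by simp
    qed
    moreover have "(\<Sum>j\<in>insert x S. ?L (insert x S) j) = ?L (insert x S) x + (\<Sum>j\<in>S. ?L (insert x S) j)"
      using insert.hyps(1) False by (rule sum.insert)
    ultimately have "(\<Sum>j\<in>insert x S. ?L (insert x S) j) \<le> a x * exp (- (a x + A)) + (1 - exp (- A))"
      using insert.IH unfolding x A_def[symmetric] by linarith
    also have "\<dots> \<le> 1 - exp (- (a x + A))"
    proof -
      have "(1 + a x) * exp (- (a x)) \<le> exp (a x) * exp (- (a x))"
        by (intro mult_right_mono exp_ge_add_one_self) auto
      then have "(1 + a x) * exp (- (a x)) \<le> 1" by (simp add: exp_minus)
      then have "((1 + a x) * exp (- (a x))) * exp (- A) \<le> 1 * exp (- A)"
        by (intro mult_right_mono) auto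
      moreover have "exp (- (a x + A)) = exp (- a x) * exp (- A)" by (simp add: exp_add[symmetric])
      ultimately show ?thesis by (simp add: algebra_simps)
    qed
    finally show ?thesis using False insert.hyps by (simp add: A_def)
  qed
qed simp

lemma prod_le_exp_neg_sum:
  fixes x :: "'i \<Rightarrow> real"
  assumes "finite S" "\<And>k. k \<in> S \<Longrightarrow> 0 \<le> x k"
  shows "(\<Prod>k\<in>S. x k) \<le> exp (- (\<Sum>k\<in>S. 1 - x k))"
proof -
  have "(\<Prod>k\<in>S. x k) \<le> (\<Prod>k\<in>S. exp (x k - 1))"
    using assms by (intro prod_mono) (auto intro: order_trans[OF _ exp_ge_add_one_self])
  also have "\<dots> = exp (- (\<Sum>k\<in>S. 1 - x k))"
    using assms(1) by (simp add: exp_sum[symmetric] sum_negf[symmetric])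
  finally show ?thesis .
qed

text \<open>The real part of the Herglotz function \<open>(1 + u) / (1 - u)\<close> is a Poisson kernel.\<close>

lemma Re_cayley: "Re ((1 + u) / (1 - u)) = (1 - (cmod u)\<^sup>2) / (cmod (1 - u))\<^sup>2"
proof -
  have "(1 + Re u) * (1 - Re u) - Im u * Im u = 1 - (cmod u)\<^sup>2"
    by (simp add: cmod_power2, simp add: power2_eq_square algebra_simps)
  then show ?thesis by (simp add: Re_divide' cmod_power2)
qed

lemma Re_of_real_mult: "Re (of_real r * u) = r * Re u"
  by simp

text \<open>P. Jones's explicit interpolating functions. With \<open>q k = 1 - \<bar>z k\<bar>\<^sup>2\<close>, the function \<open>f j\<close> is the
  Blaschke product over the other points, normalised at \<open>z j\<close>, times a square of a kernel and times
  \<open>exp (P j (z j) - P j w)\<close>, where \<open>P j\<close> is a sum of Herglotz functions over the points that lie at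
  least as close to the circle as \<open>z j\<close>. On the circle \<open>\<bar>f j\<bar>\<close> is bounded by a constant times
  \<open>a j exp (- \<Sum> a k)\<close> with \<open>a k = q k\<^sup>2 / \<bar>1 - cnj (z k) w\<bar>\<^sup>2\<close>, and these terms have a sum of at most one by
  \<open>sum_mult_exp_ranked_le\<close>. Separation enters twice: through the normalisation of the
  Blaschke product, and through the bound for \<open>Re (P j (z j))\<close>.\<close>

lemma jones_functions:
  fixes z :: "nat \<Rightarrow> complex"
  assumes S: "finite S" and z: "\<And>i. i \<in> S \<Longrightarrow> cmod (z i) < 1" and \<delta>: "0 < \<delta>"
    and sep: "\<And>j. j \<in> S \<Longrightarrow> \<delta> \<le> (\<Prod>k\<in>S - {j}. cmod (blaschke (z k) (z j)))"
  obtains f where "\<And>j. j \<in> S \<Longrightarrow> f j analytic_on cball 0 1"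
    and "\<And>j. j \<in> S \<Longrightarrow> f j (z j) = 1"
    and "\<And>i j. i \<in> S \<Longrightarrow> j \<in> S \<Longrightarrow> i \<noteq> j \<Longrightarrow> f j (z i) = 0"
    and "\<And>w. cmod w = 1 \<Longrightarrow> (\<Sum>j\<in>S. cmod (f j w)) \<le> exp 2 / \<delta> ^ 5"
proof -
  define q where "q k = 1 - (cmod (z k))\<^sup>2" for k
  define K where "K j = {k \<in> S. cmod (z j) \<le> cmod (z k)}" for j
  define P where "P j w = (\<Sum>k\<in>K j. of_real (q k) * ((1 + cnj (z k) * w) / (1 - cnj (z k) * w)))" for j w
  define B where "B j w = (\<Prod>k\<in>S - {j}. blaschke (z k) w)" for j w
  define \<alpha> where "\<alpha> j w = of_real (q j) / (1 - cnj (z j) * w)" for j w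
  define f where "f j w = B j w / B j (z j) * (\<alpha> j w)\<^sup>2 * exp (P j (z j) - P j w)" for j w
  have q: "0 < q k" "q k \<le> 1" if "k \<in> S" for k
    using one_minus_cmod_sq_pos[OF z[OF that]] by (simp_all add: q_def)
  have KS: "K j \<subseteq> S" and fK: "finite (K j)" for j using S by (auto simp: K_def)
  have cB: "\<delta> \<le> cmod (B j (z j))" if "j \<in> S" for j
    using sep[OF that] by (simp add: B_def prod_norm)
  then have B0: "B j (z j) \<noteq> 0" if "j \<in> S" for j using that \<delta> by fastforce
  have an: "f j analytic_on cball 0 1" if "j \<in> S" for j
    unfolding f_def[abs_def] B_def \<alpha>_def P_def using that KS z
    by (intro analytic_intros analytic_blaschke) (auto simp: cnj_mult_neq_one B0[unfolded B_def] subset_eq)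
  have one: "f j (z j) = 1" if "j \<in> S" for j
  proof -
    have "1 - cnj (z j) * z j = of_real (q j)"
      by (simp add: q_def complex_norm_square mult.commute del: of_real_power)
    then show ?thesis using B0[OF that] q[OF that] by (simp add: f_def \<alpha>_def)
  qed
  have zero: "f j (z i) = 0" if "i \<in> S" "j \<in> S" "i \<noteq> j" for i j
  proof -
    have "B j (z i) = 0" unfolding B_def using that S by (intro prod_zero) (auto simp: blaschke_def)
    then show ?thesis by (simp add: f_def)
  qed
  \<comment> \<open>The points of \<open>K j\<close> are at least as close to the circle as \<open>z j\<close>, so each Herglotz term at
    \<open>z j\<close> is at most twice a Blaschke defect; the defects are summable by separation.\<close>
  have RePz: "exp (Re (P j (z j))) \<le> exp 2 / \<delta> ^ 4" if j: "j \<in> S" for j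
  proof -
    define x where "x k = (cmod (blaschke (z k) (z j)))\<^sup>2" for k
    have x1: "0 \<le> 1 - x k" if "k \<in> S" for k
    proof -
      have "1 - x k = q k * q j / (cmod (1 - cnj (z k) * z j))\<^sup>2"
        unfolding x_def q_def using z[OF that] z[OF j] by (intro blaschke_defect) auto
      then show ?thesis using q[OF that] q[OF j] by simp
    qed
    have "Re (P j (z j)) \<le> (\<Sum>k\<in>K j. 2 * (1 - x k))"
      unfolding P_def Re_sum
    proof (rule sum_mono)
      fix k assume k: "k \<in> K j"
      then have kS: "k \<in> S" using KS by auto
      have "Re (of_real (q k) * ((1 + cnj (z k) * z j) / (1 - cnj (z k) * z j)))
          = q k * ((1 - (cmod (z k))\<^sup>2 * (cmod (z j))\<^sup>2) / (cmod (1 - cnj (z k) * z j))\<^sup>2)"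
        unfolding Re_of_real_mult Re_cayley by (simp add: norm_mult power_mult_distrib)
      also have "\<dots> \<le> q k * ((2 * q j) / (cmod (1 - cnj (z k) * z j))\<^sup>2)"
      proof (intro mult_left_mono divide_right_mono)
        define X Y where "X = (cmod (z k))\<^sup>2" and "Y = (cmod (z j))\<^sup>2"
        have "Y \<le> X" using k by (simp add: X_def Y_def K_def)
        moreover have "0 \<le> Y" "Y \<le> 1" using q[OF j] by (simp_all add: Y_def q_def)
        ultimately have "Y * Y \<le> X * Y" by (intro mult_right_mono)
        moreover have "0 \<le> (1 - Y) * (1 - Y)" by simp
        ultimately show "1 - (cmod (z k))\<^sup>2 * (cmod (z j))\<^sup>2 \<le> 2 * q j"
          unfolding q_def X_def[symmetric] Y_def[symmetric] by (simp add: algebra_simps)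
      qed (use q[OF kS] in auto)
      also have "\<dots> = 2 * (1 - x k)"
        unfolding x_def using z[OF kS] z[OF j] by (subst blaschke_defect) (auto simp: q_def)
      finally show "Re (of_real (q k) * ((1 + cnj (z k) * z j) / (1 - cnj (z k) * z j))) \<le> 2 * (1 - x k)" .
    qed
    also have "\<dots> \<le> (\<Sum>k\<in>S. 2 * (1 - x k))"
      using x1 by (intro sum_mono2[OF S KS]) auto
    also have "\<dots> = 2 + 2 * (\<Sum>k\<in>S - {j}. 1 - x k)"
      by (simp add: sum.remove[OF S j] sum_distrib_left x_def blaschke_def)
    finally have le: "Re (P j (z j)) \<le> 2 + 2 * (\<Sum>k\<in>S - {j}. 1 - x k)" .
    define E where "E = exp (\<Sum>k\<in>S - {j}. 1 - x k)"
    have "\<delta>\<^sup>2 \<le> (\<Prod>k\<in>S - {j}. cmod (blaschke (z k) (z j)))\<^sup>2"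
      using sep[OF j] \<delta> by (intro power_mono) auto
    also have "\<dots> = (\<Prod>k\<in>S - {j}. x k)" by (simp add: x_def prod_power_distrib)
    also have "\<dots> \<le> exp (- (\<Sum>k\<in>S - {j}. 1 - x k))"
      using S by (intro prod_le_exp_neg_sum) (auto simp: x_def)
    finally have "\<delta>\<^sup>2 \<le> inverse E" by (simp add: E_def exp_minus)
    then have "(\<delta>\<^sup>2)\<^sup>2 \<le> (inverse E)\<^sup>2" by (intro power_mono) auto
    then have d4: "\<delta> ^ 4 * E\<^sup>2 \<le> 1" by (simp add: E_def power_inverse field_simps flip: power_mult)
    have "exp (Re (P j (z j))) \<le> exp (2 + 2 * (\<Sum>k\<in>S - {j}. 1 - x k))" using le by simp
    also have "\<dots> = exp 2 * E\<^sup>2" by (simp add: E_def exp_add exp_double)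
    also have "\<dots> \<le> exp 2 * (1 / \<delta> ^ 4)"
      using d4 \<delta> by (intro mult_left_mono) (auto simp: field_simps)
    finally show ?thesis by simp
  qed
  have bound: "(\<Sum>j\<in>S. cmod (f j w)) \<le> exp 2 / \<delta> ^ 5" if w: "cmod w = 1" for w
  proof -
    define a where "a k = (q k)\<^sup>2 / (cmod (1 - cnj (z k) * w))\<^sup>2" for k
    define C where "C = exp 2 / \<delta> ^ 5"
    have C0: "0 \<le> C" using \<delta> by (simp add: C_def)
    have bnd: "cmod (f j w) \<le> C * (a j * exp (- (\<Sum>k\<in>{k\<in>S. cmod (z j) \<le> cmod (z k)}. a k)))"
      if j: "j \<in> S" for j
    proof -
      have "cmod (B j w) = 1"
        unfolding B_def prod_norm[symmetric] using z w by (intro prod.neutral) (auto simp: cmod_blaschke_circle)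
      then have 1: "cmod (B j w / B j (z j)) \<le> 1 / \<delta>"
        using cB[OF j] \<delta> by (simp add: norm_divide frac_le)
      have 2: "cmod ((\<alpha> j w)\<^sup>2) = a j"
        by (simp add: \<alpha>_def a_def norm_power norm_divide power_divide)
      have "Re (P j w) = (\<Sum>k\<in>K j. a k)"
        unfolding P_def Re_sum
      proof (rule sum.cong[OF refl])
        fix k assume "k \<in> K j"
        have "Re (of_real (q k) * ((1 + cnj (z k) * w) / (1 - cnj (z k) * w)))
          = q k * Re ((1 + cnj (z k) * w) / (1 - cnj (z k) * w))" by (rule Re_of_real_mult)
        also have "\<dots> = a k"
          unfolding Re_cayley using w by (simp add: a_def norm_mult q_def power2_eq_square)
        finally show "Re (of_real (q k) * ((1 + cnj (z k) * w) / (1 - cnj (z k) * w))) = a k" .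
      qed
      then have 3: "cmod (exp (P j (z j) - P j w)) \<le> exp 2 / \<delta> ^ 4 * exp (- (\<Sum>k\<in>K j. a k))"
        using mult_right_mono[OF RePz[OF j], of "exp (- (\<Sum>k\<in>K j. a k))"]
        by (simp add: norm_exp_eq_Re exp_add[symmetric])
      have "cmod (f j w) = cmod (B j w / B j (z j)) * (a j * cmod (exp (P j (z j) - P j w)))"
        unfolding f_def norm_mult 2 by simp
      also have "\<dots> \<le> 1 / \<delta> * (a j * (exp 2 / \<delta> ^ 4 * exp (- (\<Sum>k\<in>K j. a k))))"
        using \<delta> by (intro mult_mono 1 3) (auto simp: a_def)
      also have "\<dots> = C * (a j * exp (- (\<Sum>k\<in>K j. a k)))"
        using \<delta> by (simp add: C_def field_simps power_numeral_reduce)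
      finally show ?thesis by (simp add: K_def)
    qed
    have "(\<Sum>j\<in>S. cmod (f j w)) \<le> (\<Sum>j\<in>S. C * (a j * exp (- (\<Sum>k\<in>{k\<in>S. cmod (z j) \<le> cmod (z k)}. a k))))"
      by (intro sum_mono bnd)
    also have "\<dots> \<le> C * (1 - exp (- (\<Sum>k\<in>S. a k)))"
      unfolding sum_distrib_left[symmetric]
      by (intro mult_left_mono C0 sum_mult_exp_ranked_le S) (simp add: a_def)
    also have "\<dots> \<le> C * 1" using C0 by (intro mult_left_mono) auto
    finally show ?thesis by (simp add: C_def)
  qed
  show ?thesis by (rule that[of f]) (use an one zero bound in auto)
qed

section \<open>Riesz systems of kernels with multiplicities\<close>

text \<open>A polynomial that takes the value \<open>0\<close> at \<open>0\<close> and \<open>1\<close> at \<open>1\<close>, in both cases to order \<open>m\<close>. Composed with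
  a function of value \<open>0\<close> or \<open>1\<close> at some points, it has the same values there to order \<open>m\<close>; this
  turns simple interpolation into interpolation with multiplicities.\<close>

definition flat_step :: "nat \<Rightarrow> complex \<Rightarrow> complex" where
  "flat_step m x = 1 - (1 - x ^ m) ^ m"

lemma flat_step_factor: "flat_step m x = x ^ m * (\<Sum>l<m. (1 - x ^ m) ^ l)"
  unfolding flat_step_def one_diff_power_eq[of "1 - x ^ m" m] by simp

lemma flat_step_minus_one: "flat_step m x - 1 = (1 - x) ^ m * (- ((\<Sum>l<m. x ^ l) ^ m))"
  unfolding flat_step_def one_diff_power_eq[of x m] by (simp add: power_mult_distrib)

lemma cmod_flat_step_le:
  assumes "0 < m" "1 \<le> C" "cmod x \<le> C"
  shows "cmod (flat_step m x) \<le> (C ^ m * (real m * (1 + C ^ m) ^ m)) * cmod x"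
proof -
  have "cmod x ^ m = cmod x * cmod x ^ (m - 1)"
    using assms(1) by (simp add: power_eq_if)
  also have "\<dots> \<le> cmod x * C ^ m"
  proof (intro mult_left_mono)
    have "cmod x ^ (m - 1) \<le> C ^ (m - 1)" using assms by (intro power_mono) auto
    also have "\<dots> \<le> C ^ m" using assms by (intro power_increasing) auto
    finally show "cmod x ^ (m - 1) \<le> C ^ m" .
  qed simp
  finally have 1: "cmod x ^ m \<le> cmod x * C ^ m" .
  have "cmod (\<Sum>l<m. (1 - x ^ m) ^ l) \<le> (\<Sum>l<m. (1 + C ^ m) ^ m)"
  proof (rule order_trans[OF norm_sum], rule sum_mono)
    fix l assume l: "l \<in> {..<m}"
    have "cmod (1 - x ^ m) \<le> 1 + cmod x ^ m"
      using norm_triangle_ineq4[of 1 "x ^ m"] by (simp add: norm_power)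
    also have "\<dots> \<le> 1 + C ^ m" using assms by (intro add_left_mono power_mono) auto
    finally have "cmod (1 - x ^ m) ^ l \<le> (1 + C ^ m) ^ l" by (intro power_mono) auto
    also have "\<dots> \<le> (1 + C ^ m) ^ m" using l assms by (intro power_increasing) auto
    finally show "cmod ((1 - x ^ m) ^ l) \<le> (1 + C ^ m) ^ m" by (simp add: norm_power)
  qed
  then have 2: "cmod (\<Sum>l<m. (1 - x ^ m) ^ l) \<le> real m * (1 + C ^ m) ^ m" by simp
  have "cmod (flat_step m x) \<le> (cmod x * C ^ m) * (real m * (1 + C ^ m) ^ m)"
    unfolding flat_step_factor norm_mult norm_power using 1 2 assms by (intro mult_mono) auto
  then show ?thesis by (simp add: mult_ac)
qed

text \<open>By the parallelogram law the average of \<open>\<parallel>\<Sum> \<plusminus>X i\<parallel>\<^sup>2\<close> over all signs is \<open>\<Sum> \<parallel>X i\<parallel>\<^sup>2\<close>, hence some choice of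
  signs does not exceed this value and some choice is not below it. The sign of \<open>\<sigma>\<close> selects which
  of the two is stated.\<close>

lemma circle_sq_signs:
  fixes X :: "'i \<Rightarrow> complex \<Rightarrow> complex" and \<sigma> :: real
  assumes "finite S" "\<And>i. i \<in> S \<Longrightarrow> continuous_on (sphere 0 1) (X i)"
  shows "\<exists>\<epsilon>. (\<forall>i. \<epsilon> i \<in> {- 1, 1}) \<and>
    \<sigma> * circle_sq (\<lambda>w. \<Sum>i\<in>S. \<epsilon> i * X i w) \<le> \<sigma> * (\<Sum>i\<in>S. circle_sq (X i))"
  using assms
proof (induction S rule: finite_induct)
  case empty
  then show ?case by (auto simp: circle_sq_def circle_mean_const intro!: exI[of _ "\<lambda>_. 1"])
next
  case (insert x S)
  then obtain \<epsilon> where \<epsilon>: "\<forall>i. \<epsilon> i \<in> {- 1, 1}"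
    "\<sigma> * circle_sq (\<lambda>w. \<Sum>i\<in>S. \<epsilon> i * X i w) \<le> \<sigma> * (\<Sum>i\<in>S. circle_sq (X i))" by auto
  let ?s = "\<lambda>w. \<Sum>i\<in>S. \<epsilon> i * X i w"
  have half: "x \<le> t \<or> y \<le> t" if "x + y = 2 * t" for x y t :: real
    using that by linarith
  have "circle_sq (\<lambda>w. ?s w + X x w) + circle_sq (\<lambda>w. ?s w - X x w) = 2 * circle_sq ?s + 2 * circle_sq (X x)"
    using insert.prems by (intro circle_sq_parallelogram continuous_intros) auto
  then have "\<sigma> * (circle_sq (\<lambda>w. ?s w + X x w) + circle_sq (\<lambda>w. ?s w - X x w))
      = \<sigma> * (2 * circle_sq ?s + 2 * circle_sq (X x))"
    by (rule arg_cong)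
  then have "\<sigma> * circle_sq (\<lambda>w. ?s w + X x w) + \<sigma> * circle_sq (\<lambda>w. ?s w - X x w)
      = 2 * (\<sigma> * circle_sq ?s + \<sigma> * circle_sq (X x))"
    unfolding distrib_left by simp
  then have "\<sigma> * circle_sq (\<lambda>w. ?s w + X x w) \<le> \<sigma> * circle_sq ?s + \<sigma> * circle_sq (X x) \<or>
      \<sigma> * circle_sq (\<lambda>w. ?s w - X x w) \<le> \<sigma> * circle_sq ?s + \<sigma> * circle_sq (X x)" by (rule half)
  then obtain c where c: "c \<in> {- 1, 1}"
    "\<sigma> * circle_sq (\<lambda>w. c * X x w + ?s w) \<le> \<sigma> * circle_sq ?s + \<sigma> * circle_sq (X x)"
    by (auto simp: add.commute[of "X x _"] intro: that[of 1] that[of "- 1"])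
  have "(\<Sum>i\<in>insert x S. (\<epsilon>(x := c)) i * X i w) = c * X x w + ?s w" for w
    using insert.hyps by (auto intro!: sum.cong)
  moreover have "\<forall>i. (\<epsilon>(x := c)) i \<in> {- 1, 1}" using c(1) \<epsilon>(1) by simp
  moreover have "\<sigma> * circle_sq (\<lambda>w. c * X x w + ?s w) \<le> \<sigma> * (\<Sum>i\<in>insert x S. circle_sq (X i))"
    using c(2) \<epsilon>(2) insert.hyps by (simp add: distrib_left)
  ultimately show ?case by (intro exI[of _ "\<epsilon>(x := c)"]) presburger
qed

text \<open>Changing signs of the components of \<open>F = \<Sum> X i\<close> in the block spaces is bounded. Let \<open>\<Phi>\<close> be analytic,
  bounded by \<open>M\<close> on the circle and equal to \<open>\<epsilon> i\<close> at \<open>z i\<close> to order \<open>m\<close>. As \<open>\<Phi> - \<epsilon> i\<close> is divisible by the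
  \<open>m\<close>-th power of the Blaschke factor at \<open>z i\<close>, it is orthogonal to \<open>X i\<close>, even after multiplication by an
  analytic function: the adjoint of multiplication by \<open>\<Phi>\<close> acts on \<open>X i\<close> as \<open>\<epsilon> i\<close>. Therefore
  \<open>y = \<Sum> \<epsilon> i X i\<close> satisfies \<open>\<langle>y, y\<rangle> = \<langle>F, \<Phi> y\<rangle>\<close>, and the bound follows from \<open>\<bar>\<Phi>\<bar> \<le> M\<close>.\<close>

lemma circle_sq_sign_change:
  fixes z :: "nat \<Rightarrow> complex" and \<epsilon> :: "nat \<Rightarrow> complex"
  assumes S: "finite S" and z: "\<And>i. i \<in> S \<Longrightarrow> cmod (z i) < 1" and \<delta>: "0 < \<delta>" "\<delta> \<le> 1"
    and sep: "\<And>j. j \<in> S \<Longrightarrow> \<delta> \<le> (\<Prod>k\<in>S - {j}. cmod (blaschke (z k) (z j)))"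
    and m: "0 < m" and \<epsilon>: "\<And>i. \<epsilon> i \<in> {- 1, 1}"
    and C: "C = exp 2 / \<delta> ^ 5" and M: "M = C ^ m * (real m * (1 + C ^ m) ^ m) * C"
    and X: "X = (\<lambda>i w. \<Sum>t<m. d i t * (blaschke (z i) w ^ t * szego (z i) w))"
  shows "circle_sq (\<lambda>w. \<Sum>i\<in>S. \<epsilon> i * X i w) \<le> M\<^sup>2 * circle_sq (\<lambda>w. \<Sum>i\<in>S. X i w)"
proof -
  obtain f where fan: "\<And>j. j \<in> S \<Longrightarrow> f j analytic_on cball 0 1"
    and f1: "\<And>j. j \<in> S \<Longrightarrow> f j (z j) = 1"
    and f0: "\<And>i j. i \<in> S \<Longrightarrow> j \<in> S \<Longrightarrow> i \<noteq> j \<Longrightarrow> f j (z i) = 0"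
    and fb: "\<And>w. cmod w = 1 \<Longrightarrow> (\<Sum>j\<in>S. cmod (f j w)) \<le> C"
    by (rule jones_functions[OF S z \<delta>(1) sep]) (assumption, assumption, rule that, assumption+, simp add: C)
  have anX: "X i analytic_on cball 0 1" if "i \<in> S" for i
    unfolding X by (intro analytic_intros analytic_blaschke analytic_szego z that)
  define y where "y w = (\<Sum>i\<in>S. \<epsilon> i * X i w)" for w
  define F where "F w = (\<Sum>i\<in>S. X i w)" for w
  define \<Phi> where "\<Phi> w = (\<Sum>j\<in>S. \<epsilon> j * flat_step m (f j w))" for w
  have any: "y analytic_on cball 0 1" unfolding y_def[abs_def] by (intro analytic_intros anX)
  have an\<Phi>: "\<Phi> analytic_on cball 0 1"
    unfolding \<Phi>_def[abs_def] flat_step_def by (intro analytic_intros fan)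
  have anF: "F analytic_on cball 0 1" unfolding F_def[abs_def] by (intro analytic_intros anX)
  note cont = analytic_continuous_circle[OF any] analytic_continuous_circle[OF an\<Phi>] analytic_continuous_circle[OF anF]
  have C1: "1 \<le> C"
  proof -
    have "\<delta> ^ 5 \<le> 1" using \<delta> by (intro power_le_one) auto
    moreover have "(1::real) \<le> exp 2" by simp
    ultimately have "\<delta> ^ 5 \<le> exp 2" by linarith
    then show ?thesis unfolding C using \<delta> by (simp add: pos_le_divide_eq)
  qed
  have M0: "0 \<le> M" unfolding M using C1 by simp
  have \<epsilon>1: "cmod (\<epsilon> i) = 1" "\<epsilon> i * \<epsilon> i = 1" "cnj (\<epsilon> i) = \<epsilon> i" for i using \<epsilon>[of i] by auto
  have \<Phi>M: "cmod (\<Phi> w) \<le> M" if w: "cmod w = 1" for w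
  proof -
    have "cmod (\<Phi> w) \<le> (\<Sum>j\<in>S. (C ^ m * (real m * (1 + C ^ m) ^ m)) * cmod (f j w))"
      unfolding \<Phi>_def
    proof (rule order_trans[OF norm_sum], rule sum_mono)
      fix j assume j: "j \<in> S"
      have "cmod (f j w) \<le> C"
        using fb[OF w] member_le_sum[of j S "\<lambda>j. cmod (f j w)"] S j by fastforce
      then show "cmod (\<epsilon> j * flat_step m (f j w)) \<le> (C ^ m * (real m * (1 + C ^ m) ^ m)) * cmod (f j w)"
        using cmod_flat_step_le[OF m C1] by (simp add: norm_mult \<epsilon>1)
    qed
    also have "\<dots> \<le> (C ^ m * (real m * (1 + C ^ m) ^ m)) * C"
      unfolding sum_distrib_left[symmetric] using C1 by (intro mult_left_mono fb w) auto
    finally show ?thesis by (simp add: M)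
  qed
  \<comment> \<open>\<open>\<Phi> - \<epsilon> i\<close> is divisible by the \<open>m\<close>-th power of the Blaschke factor at \<open>z i\<close>, summand by
    summand: the value of \<open>flat_step m \<circ> f j\<close> at \<open>z i\<close> is \<open>1\<close> for \<open>j = i\<close> and \<open>0\<close> otherwise, to order \<open>m\<close>.\<close>
  have ann: "circle_mean (\<lambda>w. X i w * cnj ((\<Phi> w - \<epsilon> i) * y w)) = 0" if i: "i \<in> S" for i
  proof -
    have "\<exists>h. h analytic_on cball 0 1 \<and> (\<forall>w. cmod w = 1 \<longrightarrow>
        flat_step m (f j w) - (if j = i then 1 else 0) = blaschke (z i) w ^ m * h w)" if j: "j \<in> S" for j
    proof (cases "j = i")
      case True
      obtain r where r: "r analytic_on cball 0 1" "\<And>w. cmod w \<le> 1 \<Longrightarrow> 1 - f j w = blaschke (z i) w * r w"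
        by (rule analytic_divide_blaschke[OF z[OF i], of "\<lambda>w. 1 - f j w"])
           (auto intro!: analytic_intros fan j simp: True f1 i)
      show ?thesis
      proof (intro exI[of _ "\<lambda>w. r w ^ m * (- ((\<Sum>l<m. f j w ^ l) ^ m))"] conjI allI impI)
        show "(\<lambda>w. r w ^ m * (- ((\<Sum>l<m. f j w ^ l) ^ m))) analytic_on cball 0 1"
          by (intro analytic_intros fan j r(1))
        fix w :: complex assume "cmod w = 1"
        then have "1 - f j w = blaschke (z i) w * r w" by (intro r(2)) simp
        then show "flat_step m (f j w) - (if j = i then 1 else 0)
            = blaschke (z i) w ^ m * (r w ^ m * (- ((\<Sum>l<m. f j w ^ l) ^ m)))"
          unfolding if_P[OF True] flat_step_minus_one by (simp only: power_mult_distrib mult.assoc)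
      qed
    next
      case False
      obtain r where r: "r analytic_on cball 0 1" "\<And>w. cmod w \<le> 1 \<Longrightarrow> f j w = blaschke (z i) w * r w"
        using analytic_divide_blaschke[OF z[OF i] fan[OF j] f0[OF i j]] False by metis
      show ?thesis
      proof (intro exI[of _ "\<lambda>w. r w ^ m * (\<Sum>l<m. (1 - f j w ^ m) ^ l)"] conjI allI impI)
        show "(\<lambda>w. r w ^ m * (\<Sum>l<m. (1 - f j w ^ m) ^ l)) analytic_on cball 0 1"
          by (intro analytic_intros fan j r(1))
        fix w :: complex assume "cmod w = 1"
        then have "f j w = blaschke (z i) w * r w" by (intro r(2)) simp
        then have "f j w ^ m = blaschke (z i) w ^ m * r w ^ m" by (simp only: power_mult_distrib)
        then have "flat_step m (f j w) = (blaschke (z i) w ^ m * r w ^ m) * (\<Sum>l<m. (1 - f j w ^ m) ^ l)"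
          using flat_step_factor[of m "f j w"] by simp
        then show "flat_step m (f j w) - (if j = i then 1 else 0)
            = blaschke (z i) w ^ m * (r w ^ m * (\<Sum>l<m. (1 - f j w ^ m) ^ l))"
          unfolding if_not_P[OF False] by (simp only: mult.assoc diff_zero)
      qed
    qed
    then obtain h where h: "\<And>j. j \<in> S \<Longrightarrow> h j analytic_on cball 0 1"
      "\<And>j w. j \<in> S \<Longrightarrow> cmod w = 1 \<Longrightarrow>
        flat_step m (f j w) - (if j = i then 1 else 0) = blaschke (z i) w ^ m * h j w" by metis
    define H where "H w = (\<Sum>j\<in>S. \<epsilon> j * h j w) * y w" for w
    have anH: "H analytic_on cball 0 1" unfolding H_def[abs_def] by (intro analytic_intros h any)
    have "circle_mean (\<lambda>w. X i w * cnj ((\<Phi> w - \<epsilon> i) * y w))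
      = circle_mean (\<lambda>w. \<Sum>t<m. d i t * ((blaschke (z i) w ^ t * szego (z i) w) * cnj (blaschke (z i) w ^ m * H w)))"
    proof (rule circle_mean_cong)
      fix w :: complex assume w: "cmod w = 1"
      have "\<Phi> w - \<epsilon> i = (\<Sum>j\<in>S. \<epsilon> j * (flat_step m (f j w) - (if j = i then 1 else 0)))"
        using S i by (simp add: \<Phi>_def right_diff_distrib sum_subtractf if_distrib[of "\<lambda>x. _ * x"] cong: if_cong)
      also have "\<dots> = (\<Sum>j\<in>S. \<epsilon> j * (blaschke (z i) w ^ m * h j w))"
        by (intro sum.cong refl) (simp only: h(2)[OF _ w])
      finally have "(\<Phi> w - \<epsilon> i) * y w = blaschke (z i) w ^ m * H w"
        by (simp add: H_def sum_distrib_left sum_distrib_right mult_ac)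
      then show "X i w * cnj ((\<Phi> w - \<epsilon> i) * y w)
        = (\<Sum>t<m. d i t * ((blaschke (z i) w ^ t * szego (z i) w) * cnj (blaschke (z i) w ^ m * H w)))"
        by (simp only: X sum_distrib_right mult.assoc)
    qed
    also have "\<dots> = (\<Sum>t<m. d i t * circle_mean (\<lambda>w. (blaschke (z i) w ^ t * szego (z i) w) * cnj (blaschke (z i) w ^ m * H w)))"
      using z[OF i]
      by (subst circle_mean_sum, simp,
          (intro continuous_intros analytic_continuous_circle[OF analytic_blaschke]
            analytic_continuous_circle[OF analytic_szego] analytic_continuous_circle[OF anH]; assumption),
          simp only: circle_mean_cmult)
    also have "\<dots> = 0"
      by (intro sum.neutral ballI) (simp only: mean_block_annihilates[OF z[OF i] anH] lessThan_iff mult_zero_right)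
    finally show ?thesis .
  qed
  have "of_real (circle_sq y) = circle_mean (\<lambda>w. y w * cnj (y w))"
    by (rule of_real_circle_sq[OF cont(1)])
  also have "\<dots> = circle_mean (\<lambda>w. F w * cnj (\<Phi> w * y w) - (\<Sum>i\<in>S. X i w * cnj ((\<Phi> w - \<epsilon> i) * y w)))"
  proof (rule circle_mean_cong)
    fix w
    have "F w * cnj (\<Phi> w * y w) - (\<Sum>i\<in>S. X i w * cnj ((\<Phi> w - \<epsilon> i) * y w))
      = (\<Sum>i\<in>S. X i w * cnj (\<Phi> w * y w) - X i w * cnj ((\<Phi> w - \<epsilon> i) * y w))"
      by (simp add: F_def sum_distrib_right sum_subtractf)
    also have "\<dots> = (\<Sum>i\<in>S. \<epsilon> i * X i w * cnj (y w))"
      by (intro sum.cong refl) (simp add: algebra_simps \<epsilon>1)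
    finally show "y w * cnj (y w) = F w * cnj (\<Phi> w * y w) - (\<Sum>i\<in>S. X i w * cnj ((\<Phi> w - \<epsilon> i) * y w))"
      by (simp add: y_def sum_distrib_right)
  qed
  also have "\<dots> = circle_mean (\<lambda>w. F w * cnj (\<Phi> w * y w)) - (\<Sum>i\<in>S. circle_mean (\<lambda>w. X i w * cnj ((\<Phi> w - \<epsilon> i) * y w)))"
    using cont analytic_continuous_circle[OF anX] S
    by (subst circle_mean_diff, (intro continuous_intros; simp), (intro continuous_intros; simp),
        subst circle_mean_sum) (auto intro!: continuous_intros)
  also have "\<dots> = circle_mean (\<lambda>w. F w * cnj (\<Phi> w * y w))" using ann by simp
  finally have "circle_sq y = cmod (circle_mean (\<lambda>w. F w * cnj (\<Phi> w * y w)))"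
    using circle_sq_nonneg[OF cont(1)] by (metis abs_of_nonneg norm_of_real)
  \<comment> \<open>A weighted arithmetic-geometric mean inequality; the resulting multiple of \<open>circle_sq y\<close> is
    absorbed on the left.\<close>
  also have "\<dots> \<le> circle_mean (\<lambda>w. M\<^sup>2 / 2 * (cmod (F w))\<^sup>2 + 1 / 2 * (cmod (y w))\<^sup>2)"
  proof (rule circle_mean_norm_le)
    fix w :: complex assume w: "cmod w = 1"
    have "cmod (F w * cnj (\<Phi> w * y w)) = cmod (\<Phi> w) * (cmod (F w) * cmod (y w))" by (simp add: norm_mult)
    also have "\<dots> \<le> M * (cmod (F w) * cmod (y w))" by (intro mult_right_mono \<Phi>M w) auto
    also have "\<dots> \<le> M\<^sup>2 / 2 * (cmod (F w))\<^sup>2 + 1 / 2 * (cmod (y w))\<^sup>2"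
      using sum_squares_bound[of "M * cmod (F w)" "cmod (y w)"] by (simp add: power_mult_distrib)
    finally show "cmod (F w * cnj (\<Phi> w * y w)) \<le> M\<^sup>2 / 2 * (cmod (F w))\<^sup>2 + 1 / 2 * (cmod (y w))\<^sup>2" .
  qed (use cont in \<open>auto intro!: continuous_intros\<close>)
  also have "\<dots> = M\<^sup>2 / 2 * circle_sq F + 1 / 2 * circle_sq y"
    unfolding circle_sq_def using cont
    by (subst circle_mean_add) (auto intro!: continuous_intros simp: circle_mean_cmult simp del: times_divide_eq_left)
  finally have "circle_sq y \<le> M\<^sup>2 * circle_sq F" by simp
  then show ?thesis by (simp add: y_def[abs_def] F_def[abs_def])
qed

text \<open>The block spaces at separated points form a Riesz system, with a constant that depends on the
  separation and the block size only. As the norm is insensitive to changes of signs by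
  \<open>circle_sq_sign_change\<close>, it may be compared with the averages in \<open>circle_sq_signs\<close>.\<close>

lemma blaschke_blocks_riesz:
  assumes \<delta>: "0 < \<delta>" "\<delta> \<le> 1" and m: "0 < m"
  shows "\<exists>M>0. \<forall>S (z :: nat \<Rightarrow> complex) d. finite S \<longrightarrow> (\<forall>i\<in>S. cmod (z i) < 1) \<longrightarrow>
      (\<forall>j\<in>S. \<delta> \<le> (\<Prod>k\<in>S - {j}. cmod (blaschke (z k) (z j)))) \<longrightarrow>
      (\<Sum>i\<in>S. \<Sum>t<m. (cmod (d i t))\<^sup>2)
        \<le> M * circle_sq (\<lambda>w. \<Sum>i\<in>S. \<Sum>t<m. d i t * (blaschke (z i) w ^ t * szego (z i) w)) \<and>
      circle_sq (\<lambda>w. \<Sum>i\<in>S. \<Sum>t<m. d i t * (blaschke (z i) w ^ t * szego (z i) w))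
        \<le> M * (\<Sum>i\<in>S. \<Sum>t<m. (cmod (d i t))\<^sup>2)"
proof -
  define C where "C = exp 2 / \<delta> ^ 5"
  define M where "M = C ^ m * (real m * (1 + C ^ m) ^ m) * C"
  have C0: "0 < C" using \<delta> by (simp add: C_def)
  then have "0 < 1 + C ^ m" by (simp add: add_pos_pos)
  then have M0: "0 < M" unfolding M_def using C0 m by simp
  show ?thesis
  proof (rule exI[of _ "M\<^sup>2"], rule conjI, use M0 in simp, intro allI impI)
    fix S :: "nat set" and z :: "nat \<Rightarrow> complex" and d :: "nat \<Rightarrow> nat \<Rightarrow> complex"
    assume S: "finite S" and "\<forall>i\<in>S. cmod (z i) < 1"
      and "\<forall>j\<in>S. \<delta> \<le> (\<Prod>k\<in>S - {j}. cmod (blaschke (z k) (z j)))"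
    then have z: "\<And>i. i \<in> S \<Longrightarrow> cmod (z i) < 1"
      and sep: "\<And>j. j \<in> S \<Longrightarrow> \<delta> \<le> (\<Prod>k\<in>S - {j}. cmod (blaschke (z k) (z j)))" by simp_all
    define X where "X d i w = (\<Sum>t<m. d i t * (blaschke (z i) w ^ t * szego (z i) w))"
      for d :: "nat \<Rightarrow> nat \<Rightarrow> complex" and i w
    have X': "X d = (\<lambda>i w. \<Sum>t<m. d i t * (blaschke (z i) w ^ t * szego (z i) w))" for d
      by (simp add: X_def[abs_def])
    have contX: "continuous_on (sphere 0 1) (X d i)" if "i \<in> S" for d i
      unfolding X_def[abs_def] using that z
      by (intro analytic_continuous_circle analytic_intros analytic_blaschke analytic_szego) auto
    have sqX: "(\<Sum>i\<in>S. circle_sq (X d i)) = (\<Sum>i\<in>S. \<Sum>t<m. (cmod (d i t))\<^sup>2)"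
      unfolding X_def[abs_def] by (intro sum.cong refl circle_sq_block z)
    have change: "circle_sq (\<lambda>w. \<Sum>i\<in>S. \<epsilon> i * X e i w) \<le> M\<^sup>2 * circle_sq (\<lambda>w. \<Sum>i\<in>S. X e i w)"
      if "\<forall>i. \<epsilon> i \<in> {- 1, 1}" for \<epsilon> e
      by (rule circle_sq_sign_change[OF S z \<delta> sep m _ C_def M_def X']) (use that in auto)
    have "\<exists>\<epsilon>. (\<forall>i. \<epsilon> i \<in> {- 1, 1}) \<and>
      (- 1) * circle_sq (\<lambda>w. \<Sum>i\<in>S. \<epsilon> i * X d i w) \<le> (- 1) * (\<Sum>i\<in>S. circle_sq (X d i))"
      by (intro circle_sq_signs S contX)
    then obtain \<epsilon> where \<epsilon>: "\<forall>i. \<epsilon> i \<in> {- 1, 1}"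
      "(- 1) * circle_sq (\<lambda>w. \<Sum>i\<in>S. \<epsilon> i * X d i w) \<le> (- 1) * (\<Sum>i\<in>S. circle_sq (X d i))"
      by (elim exE conjE)
    have "(\<Sum>i\<in>S. circle_sq (X d i)) \<le> M\<^sup>2 * circle_sq (\<lambda>w. \<Sum>i\<in>S. X d i w)"
      using change[OF \<epsilon>(1), of d] \<epsilon>(2) by linarith
    moreover
    have "\<exists>\<eta>. (\<forall>i. \<eta> i \<in> {- 1, 1}) \<and>
      1 * circle_sq (\<lambda>w. \<Sum>i\<in>S. \<eta> i * X d i w) \<le> 1 * (\<Sum>i\<in>S. circle_sq (X d i))"
      by (intro circle_sq_signs S contX)
    then obtain \<eta> where \<eta>: "\<forall>i. \<eta> i \<in> {- 1, 1}"
      "1 * circle_sq (\<lambda>w. \<Sum>i\<in>S. \<eta> i * X d i w) \<le> 1 * (\<Sum>i\<in>S. circle_sq (X d i))"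
      by (elim exE conjE)
    \<comment> \<open>The upper bound results from changing the signs \<open>\<eta>\<close> back.\<close>
    have sq: "\<eta> i * \<eta> i = 1" for i using \<eta>(1)[rule_format, of i] by auto
    have Xe: "X (\<lambda>i t. \<eta> i * d i t) i w = \<eta> i * X d i w" for i w
      by (simp add: X_def sum_distrib_left mult.assoc)
    have "circle_sq (\<lambda>w. \<Sum>i\<in>S. X d i w) \<le> M\<^sup>2 * circle_sq (\<lambda>w. \<Sum>i\<in>S. \<eta> i * X d i w)"
      using change[OF \<eta>(1), of "\<lambda>i t. \<eta> i * d i t"] by (simp add: Xe mult.assoc[symmetric] sq)
    then have "circle_sq (\<lambda>w. \<Sum>i\<in>S. X d i w) \<le> M\<^sup>2 * (\<Sum>i\<in>S. circle_sq (X d i))"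
      using mult_left_mono[OF \<eta>(2), of "M\<^sup>2"] unfolding mult_1 by (meson order_trans zero_le_power2)
    ultimately show "(\<Sum>i\<in>S. \<Sum>t<m. (cmod (d i t))\<^sup>2)
        \<le> M\<^sup>2 * circle_sq (\<lambda>w. \<Sum>i\<in>S. \<Sum>t<m. d i t * (blaschke (z i) w ^ t * szego (z i) w)) \<and>
      circle_sq (\<lambda>w. \<Sum>i\<in>S. \<Sum>t<m. d i t * (blaschke (z i) w ^ t * szego (z i) w))
        \<le> M\<^sup>2 * (\<Sum>i\<in>S. \<Sum>t<m. (cmod (d i t))\<^sup>2)"
      unfolding sqX by (simp add: X_def)
  qed
qed

section \<open>Separation from a lower Riesz bound\<close>

text \<open>A partial fraction decomposition. The coefficient of \<open>szego b\<close> is the value of the Blaschke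
  factor at the reflected point \<open>1 / cnj b\<close>.\<close>

lemma blaschke_mult_szego:
  assumes a: "cmod a < 1" and b: "cmod b < 1" and "a \<noteq> b"
  shows "\<exists>\<alpha>. \<forall>w. cmod w \<le> 1 \<longrightarrow>
    blaschke a w * szego b w = \<alpha> * szego a w + szego b w / cnj (blaschke a b)"
proof -
  define s where "s x = complex_of_real (sqrt (1 - (cmod x)\<^sup>2))" for x
  have s0: "s a \<noteq> 0" using one_minus_cmod_sq_pos[OF a] by (simp add: s_def)
  have ab: "cnj a - cnj b \<noteq> 0" "cnj b - cnj a \<noteq> 0" using assms(3) by auto
  have nz1: "1 - a * cnj b \<noteq> 0"
    using one_minus_cnj_mult_nonzero[OF b, of a] a by (simp add: mult.commute)
  have \<beta>: "1 / cnj (blaschke a b) = (1 - a * cnj b) / (cnj b - cnj a)"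
    by (simp add: blaschke_def)
  show ?thesis
  proof (intro exI allI impI)
    fix w :: complex assume w: "cmod w \<le> 1"
    define u v where "u = 1 - cnj a * w" and "v = 1 - cnj b * w"
    have uv: "u \<noteq> 0" "v \<noteq> 0"
      using one_minus_cnj_mult_nonzero[OF a w] one_minus_cnj_mult_nonzero[OF b w] by (simp_all add: u_def v_def)
    have "(w - a) * (cnj b - cnj a) = (1 - a * cnj b) * u - (1 - a * cnj a) * v"
      by (simp add: u_def v_def algebra_simps)
    then have "w - a = ((1 - a * cnj b) * u - (1 - a * cnj a) * v) / (cnj b - cnj a)"
      using ab by (simp add: eq_divide_eq)
    then have "(w - a) / (u * v) = (1 - a * cnj b) / (cnj b - cnj a) / v - (1 - a * cnj a) / (cnj b - cnj a) / u"
      using uv by (simp add: diff_divide_distrib)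
    then have eq: "s b * ((w - a) / (u * v))
       = (- s b * (1 - a * cnj a) / (cnj b - cnj a)) / u + (s b / v) * ((1 - a * cnj b) / (cnj b - cnj a))"
      unfolding divide_inverse by (simp only: right_diff_distrib mult_ac) (simp add: mult_ac)
    show "blaschke a w * szego b w
      = (- s b * (1 - a * cnj a) / (cnj b - cnj a) / s a) * szego a w + szego b w / cnj (blaschke a b)"
      (is "_ = (?X / s a) * _ + _")
    proof -
      have "blaschke a w * szego b w = s b * ((w - a) / (u * v))"
        by (simp add: blaschke_def szego_def s_def u_def v_def)
      moreover have "(?X / s a) * szego a w = ?X / u"
        unfolding szego_def s_def[symmetric] u_def[symmetric] using s0 by simp
      moreover have "szego b w / cnj (blaschke a b) = (s b / v) * ((1 - a * cnj b) / (cnj b - cnj a))"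
        unfolding \<beta>[symmetric] by (simp add: szego_def s_def v_def)
      ultimately show ?thesis using eq by simp
    qed
  qed
qed

lemma blaschke_product_mult_szego:
  fixes z :: "nat \<Rightarrow> complex"
  assumes "finite S" "i \<notin> S" "inj_on z (insert i S)" "\<And>k. k \<in> insert i S \<Longrightarrow> cmod (z k) < 1"
  shows "\<exists>h. h i = 1 / cnj (\<Prod>k\<in>S. blaschke (z k) (z i)) \<and>
    (\<forall>w. cmod w \<le> 1 \<longrightarrow>
      (\<Prod>k\<in>S. blaschke (z k) w) * szego (z i) w = (\<Sum>j\<in>insert i S. h j * szego (z j) w))"
  using assms
proof (induction S rule: finite_induct)
  case empty
  then show ?case by (intro exI[of _ "\<lambda>_. 1"]) auto
next
  case (insert x S)
  have "inj_on z (insert i S)" using insert.prems(2) by (rule inj_on_subset) auto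
  then obtain h where h: "h i = 1 / cnj (\<Prod>k\<in>S. blaschke (z k) (z i))"
    "\<And>w. cmod w \<le> 1 \<Longrightarrow>
      (\<Prod>k\<in>S. blaschke (z k) w) * szego (z i) w = (\<Sum>j\<in>insert i S. h j * szego (z j) w)"
    using insert.IH insert.prems by blast
  have "\<exists>\<alpha>. \<forall>w. cmod w \<le> 1 \<longrightarrow>
    blaschke (z x) w * szego (z j) w = \<alpha> * szego (z x) w + szego (z j) w / cnj (blaschke (z x) (z j))"
    if "j \<in> insert i S" for j
  proof -
    have "z x \<noteq> z j" using that insert.prems insert.hyps inj_onD[OF insert.prems(2), of x j] by auto
    then show ?thesis
      using insert.prems(3) that by (intro blaschke_mult_szego) auto
  qed
  then obtain \<alpha> where \<alpha>: "\<And>j w. j \<in> insert i S \<Longrightarrow> cmod w \<le> 1 \<Longrightarrow>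
    blaschke (z x) w * szego (z j) w = \<alpha> j * szego (z x) w + szego (z j) w / cnj (blaschke (z x) (z j))"
    by metis
  \<comment> \<open>Every kernel in the combination contributes to the new kernel at \<open>z x\<close>.\<close>
  define h' where "h' = (\<lambda>j. if j = x then (\<Sum>j\<in>insert i S. h j * \<alpha> j) else h j / cnj (blaschke (z x) (z j)))"
  show ?case
  proof (intro exI[of _ h'] conjI allI impI)
    have "i \<noteq> x" using insert.prems by auto
    then show "h' i = 1 / cnj (\<Prod>k\<in>insert x S. blaschke (z k) (z i))"
      using insert.hyps by (simp add: h'_def h(1))
    fix w :: complex assume w: "cmod w \<le> 1"
    have x: "x \<notin> insert i S" using insert.hyps insert.prems by auto
    have "(\<Prod>k\<in>insert x S. blaschke (z k) w) * szego (z i) w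
      = blaschke (z x) w * ((\<Prod>k\<in>S. blaschke (z k) w) * szego (z i) w)"
      using insert.hyps by (simp add: mult.assoc)
    also have "\<dots> = (\<Sum>j\<in>insert i S. h j * (blaschke (z x) w * szego (z j) w))"
      unfolding h(2)[OF w] sum_distrib_left by (simp add: mult_ac)
    also have "\<dots> = (\<Sum>j\<in>insert i S. h j * \<alpha> j * szego (z x) w + h j / cnj (blaschke (z x) (z j)) * szego (z j) w)"
      by (intro sum.cong refl) (simp add: \<alpha> w distrib_left)
    also have "\<dots> = h' x * szego (z x) w + (\<Sum>j\<in>insert i S. h' j * szego (z j) w)"
    proof -
      have "(\<Sum>j\<in>insert i S. h j / cnj (blaschke (z x) (z j)) * szego (z j) w) = (\<Sum>j\<in>insert i S. h' j * szego (z j) w)"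
        using x by (intro sum.cong refl) (auto simp: h'_def)
      moreover have "(\<Sum>j\<in>insert i S. h j * \<alpha> j * szego (z x) w) = h' x * szego (z x) w"
        by (simp only: h'_def sum_distrib_right if_P[OF refl])
      ultimately show ?thesis by (simp only: sum.distrib)
    qed
    also have "\<dots> = (\<Sum>j\<in>insert x (insert i S). h' j * szego (z j) w)"
      by (rule sum.insert[symmetric]) (use insert.hyps x in auto)
    finally show "(\<Prod>k\<in>insert x S. blaschke (z k) w) * szego (z i) w = (\<Sum>j\<in>insert i (insert x S). h' j * szego (z j) w)"
      by (simp only: insert_commute)
  qed
qed

text \<open>A lower Riesz bound forces separation: the function \<open>B k\<close>, where \<open>B\<close> is the Blaschke product
  over \<open>S\<close> and \<open>k\<close> the kernel at \<open>z i\<close>, has norm one, but as a combination of kernels its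
  coefficient at \<open>i\<close> has modulus \<open>1 / \<bar>B (z i)\<bar>\<close>.\<close>

lemma szego_riesz_imp_separated:
  fixes z :: "nat \<Rightarrow> complex"
  assumes S: "finite S" "i \<notin> S" "inj_on z (insert i S)" "\<And>k. k \<in> insert i S \<Longrightarrow> cmod (z k) < 1"
    and A: "0 \<le> A" and riesz: "\<And>h. A * (\<Sum>j\<in>insert i S. (cmod (h j))\<^sup>2) \<le> circle_sq (\<lambda>w. \<Sum>j\<in>insert i S. h j * szego (z j) w)"
  shows "A \<le> (\<Prod>k\<in>S. cmod (blaschke (z k) (z i)))\<^sup>2"
proof -
  define B where "B w = (\<Prod>k\<in>S. blaschke (z k) w)" for w
  obtain h where h: "h i = 1 / cnj (B (z i))"
    "\<And>w. cmod w \<le> 1 \<Longrightarrow> B w * szego (z i) w = (\<Sum>j\<in>insert i S. h j * szego (z j) w)"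
    using blaschke_product_mult_szego[OF S] unfolding B_def by auto
  have "blaschke (z k) (z i) \<noteq> 0" if "k \<in> S" for k
  proof -
    have "z k \<noteq> z i" using S that by (auto simp: inj_on_def)
    then show ?thesis
      using one_minus_cnj_mult_nonzero[of "z k" "z i"] S(4)[of k] S(4)[of i] that by (simp add: blaschke_def)
  qed
  then have B0: "B (z i) \<noteq> 0" using S(1) by (simp add: B_def)
  have "A * (cmod (h i))\<^sup>2 \<le> A * (\<Sum>j\<in>insert i S. (cmod (h j))\<^sup>2)"
    using S(1) A by (intro mult_left_mono member_le_sum) auto
  also have "\<dots> \<le> circle_sq (\<lambda>w. \<Sum>j\<in>insert i S. h j * szego (z j) w)" by (rule riesz)
  also have "\<dots> = circle_sq (szego (z i))"
  proof (rule circle_sq_cong)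
    fix w :: complex assume w: "cmod w = 1"
    have "cmod (B w) = 1"
      unfolding B_def prod_norm[symmetric] using S(4) w by (intro prod.neutral) (auto simp: cmod_blaschke_circle)
    then show "cmod (\<Sum>j\<in>insert i S. h j * szego (z j) w) = cmod (szego (z i) w)"
      using h(2)[of w, symmetric] w by (simp only: norm_mult mult_1 order_refl)
  qed
  also have "\<dots> = 1" using S(4) by (intro circle_sq_szego) auto
  finally have "A / (cmod (B (z i)))\<^sup>2 \<le> 1" by (simp add: h(1) norm_divide power_divide)
  then have "A \<le> (cmod (B (z i)))\<^sup>2" using B0 by (simp add: divide_le_eq)
  then show ?thesis by (simp add: B_def prod_norm)
qed

section \<open>Generating functions of orbits\<close>

text \<open>The generating function \<open>\<Sum>\<^sub>k cnj (x\<^sub>k) w\<^sup>k\<close> of the coordinates \<open>x\<^sub>k\<close> with index \<open>r\<close> of the orbit of the vector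
  \<open>c\<close>, rescaled by \<open>sqrt (1 - \<bar>a\<bar>\<^sup>2)\<close>, under one Jordan block with eigenvalue \<open>a\<close>; see
  \<open>orbit_coordinate_power_series\<close>.\<close>

primrec block_symbol :: "(nat \<Rightarrow> complex) \<Rightarrow> complex \<Rightarrow> nat \<Rightarrow> complex \<Rightarrow> complex" where
  "block_symbol c a 0 w = cnj (c 0) * szego a w"
| "block_symbol c a (Suc r) w = cnj (c (Suc r)) * szego a w + (blaschke a w + a) * block_symbol c a r w"

text \<open>Summing the recurrence \<open>x\<^sub>k\<^sub>+\<^sub>1 = a x\<^sub>k + b y\<^sub>k\<close> against \<open>w\<^sup>k\<^sup>+\<^sup>1\<close> gives a linear equation for the
  generating function of \<open>x\<close>. Summing norms in the same way bounds the partial sums of \<open>\<bar>x\<^sub>k\<bar>\<close>.\<close>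

lemma first_order_recurrence_power_series:
  fixes x y :: "nat \<Rightarrow> complex"
  assumes rec: "\<And>k. x (Suc k) = a * x k + b * y k" and a: "cmod a < 1"
    and y: "summable (\<lambda>k. cmod (y k))"
    and Y: "\<And>w. cmod w = 1 \<Longrightarrow> (\<lambda>k. y k * w ^ k) sums Y w"
  shows "summable (\<lambda>k. cmod (x k))"
    and "\<And>w. cmod w = 1 \<Longrightarrow> (\<lambda>k. x k * w ^ k) sums ((x 0 + b * w * Y w) / (1 - a * w))"
proof -
  define s where "s = (\<Sum>k. cmod (y k))"
  have part: "(\<Sum>k<K. cmod (x k)) \<le> (cmod (x 0) + cmod b * s) / (1 - cmod a)" for K
  proof -
    have "(\<Sum>k<K. cmod (x k)) \<le> (\<Sum>k<Suc K. cmod (x k))" by simp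
    also have "\<dots> = cmod (x 0) + (\<Sum>k<K. cmod (x (Suc k)))" by (simp only: sum.lessThan_Suc_shift)
    also have "\<dots> \<le> cmod (x 0) + (\<Sum>k<K. cmod a * cmod (x k) + cmod b * cmod (y k))"
      unfolding rec by (intro add_left_mono sum_mono order_trans[OF norm_triangle_ineq]) (simp add: norm_mult)
    also have "\<dots> = cmod (x 0) + cmod a * (\<Sum>k<K. cmod (x k)) + cmod b * (\<Sum>k<K. cmod (y k))"
      by (simp add: sum.distrib sum_distrib_left)
    also have "\<dots> \<le> cmod (x 0) + cmod a * (\<Sum>k<K. cmod (x k)) + cmod b * s"
      unfolding s_def using sum_le_suminf[OF y, of "{..<K}"] by (intro add_left_mono mult_left_mono) auto
    finally have "(1 - cmod a) * (\<Sum>k<K. cmod (x k)) \<le> cmod (x 0) + cmod b * s" by (simp add: algebra_simps)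
    then show ?thesis using a by (simp add: le_divide_eq mult.commute)
  qed
  show sx: "summable (\<lambda>k. cmod (x k))" by (rule bounded_imp_summable[OF _ part[of "Suc _", unfolded lessThan_Suc_atMost]]) simp
  fix w :: complex assume w: "cmod w = 1"
  have "summable (\<lambda>k. cmod (x k * w ^ k))" using sx by (simp add: norm_mult norm_power w)
  then have "summable (\<lambda>k. x k * w ^ k)" by (rule summable_norm_cancel)
  then obtain X where X: "(\<lambda>k. x k * w ^ k) sums X" by (auto simp: summable_def)
  have "(\<lambda>k. (a * w) * (x k * w ^ k) + (b * w) * (y k * w ^ k)) sums ((a * w) * X + (b * w) * Y w)"
    by (intro sums_add sums_mult X Y w)
  then have "(\<lambda>k. x (Suc k) * w ^ Suc k) sums ((a * w) * X + (b * w) * Y w)"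
    by (simp add: rec algebra_simps)
  then have "(\<lambda>k. x k * w ^ k) sums ((a * w) * X + (b * w) * Y w + x 0 * w ^ 0)"
    by (rule sums_Suc)
  note X_eq = sums_unique2[OF X this, unfolded power_0 mult_1_right]
  have "u - p = q + r" if "u = p + q + r" for u p q r :: complex using that by simp
  from this[OF X_eq] have "X * (1 - a * w) = x 0 + b * w * Y w" by (simp add: algebra_simps)
  moreover have "1 - a * w \<noteq> 0"
    using one_minus_cnj_mult_nonzero[of "cnj a" w] a w by simp
  ultimately have "X = (x 0 + b * w * Y w) / (1 - a * w)" by (simp add: eq_divide_eq)
  then show "(\<lambda>k. x k * w ^ k) sums ((x 0 + b * w * Y w) / (1 - a * w))" using X by simp
qed

text \<open>The weight \<open>1 - \<bar>a\<bar>\<^sup>2\<close> on the subdiagonal of a Jordan block is chosen such that this identity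
  holds: one step down the block multiplies generating functions by \<open>b + a\<close>.\<close>

lemma blaschke_plus_center:
  assumes "cmod a < 1" "cmod w \<le> 1"
  shows "blaschke a w + a = (1 - (of_real (cmod a))\<^sup>2) * w / (1 - cnj a * w)"
proof -
  have "(1 - (of_real (cmod a))\<^sup>2 :: complex) = 1 - a * cnj a"
    by (simp flip: complex_norm_square of_real_power)
  then show ?thesis using one_minus_cnj_mult_nonzero[OF assms]
    by (simp add: blaschke_def field_simps)
qed

lemma jordan_sum_coordinate:
  assumes r: "r < n i"
  shows "jordan_sum n z f (r + offset n i) = z i * f (r + offset n i) +
    (if r = 0 then 0 else (1 - (of_real (cmod (z i)))\<^sup>2) * f (r - 1 + offset n i))"
proof -
  let ?v = "\<lambda>j. f (j + offset n i)" and ?q = "1 - (of_real (cmod (z i)))\<^sup>2 :: complex"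
  have "jordan_sum n z f (r + offset n i) = jordan_block (n i) (z i) ?v r"
    by (simp add: jordan_sum_def block_diag_def block_of_offset[of r n i, OF r])
  also have "\<dots> = (\<Sum>j<n i. (if j = r then z i * ?v j else 0) + (if Suc j = r then ?q * ?v j else 0))"
    unfolding jordan_block_def using r by (intro sum.cong refl) (auto simp: unit_vec_def)
  also have "\<dots> = z i * ?v r + (\<Sum>j<n i. if Suc j = r then ?q * ?v j else 0)"
    using r by (simp add: sum.distrib)
  also have "(\<Sum>j<n i. if Suc j = r then ?q * ?v j else 0) = (if r = 0 then 0 else ?q * ?v (r - 1))"
  proof (cases r)
    case (Suc r')
    then have "(\<Sum>j<n i. if Suc j = r then ?q * ?v j else 0) = (\<Sum>j<n i. if j = r' then ?q * ?v j else 0)"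
      by (intro sum.cong) auto
    then show ?thesis using r Suc by simp
  qed simp
  finally show ?thesis .
qed

text \<open>On the conjugated coordinates of the orbit the operator acts by the recurrence of
  \<open>first_order_recurrence_power_series\<close>, whose inhomogeneity is the preceding coordinate of the block.\<close>

lemma orbit_coordinate_power_series:
  fixes n :: "nat \<Rightarrow> nat" and z g :: "nat \<Rightarrow> complex"
  assumes a: "cmod (z i) < 1" and r: "r < n i"
  defines "c \<equiv> \<lambda>j. g (j + offset n i) / of_real (sqrt (1 - (cmod (z i))\<^sup>2))"
  shows "summable (\<lambda>k. cmod (cnj ((jordan_sum n z ^^ k) g (r + offset n i)))) \<and>
    (\<forall>w. cmod w = 1 \<longrightarrow>
      (\<lambda>k. cnj ((jordan_sum n z ^^ k) g (r + offset n i)) * w ^ k) sums block_symbol c (z i) r w)"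
  using r
proof (induction r)
  let ?x = "\<lambda>r k. cnj ((jordan_sum n z ^^ k) g (r + offset n i))"
  let ?q = "1 - (of_real (cmod (z i)))\<^sup>2 :: complex" and ?s = "complex_of_real (sqrt (1 - (cmod (z i))\<^sup>2))"
  have s0: "?s \<noteq> 0" using one_minus_cmod_sq_pos[OF a] by simp
  have x0: "?x r 0 = cnj (c r) * ?s" for r using s0 by (simp add: c_def)
  {
    case 0
    have rec: "?x 0 (Suc k) = cnj (z i) * ?x 0 k + 0 * 0" for k
      using jordan_sum_coordinate[of 0 n i] 0 by simp
    have "cmod (cnj (z i)) < 1" using a by simp
    note ps = first_order_recurrence_power_series[of "?x 0" _ 0 "\<lambda>_. 0" "\<lambda>_. 0", OF rec this]
    show ?case
      using ps x0[of 0] by (auto simp: szego_def)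
  next
    case (Suc r)
    have rec: "?x (Suc r) (Suc k) = cnj (z i) * ?x (Suc r) k + ?q * ?x r k" for k
      using jordan_sum_coordinate[of "Suc r" n i] Suc.prems by simp
    have a': "cmod (cnj (z i)) < 1" using a by simp
    have IH: "summable (\<lambda>k. cmod (?x r k))"
      "\<And>w. cmod w = 1 \<Longrightarrow> (\<lambda>k. ?x r k * w ^ k) sums block_symbol c (z i) r w"
      using Suc by auto
    note ps = first_order_recurrence_power_series[of "?x (Suc r)", OF rec a' IH]
    have "(?x (Suc r) 0 + ?q * w * block_symbol c (z i) r w) / (1 - cnj (z i) * w) = block_symbol c (z i) (Suc r) w"
      if "cmod w = 1" for w
      unfolding x0 block_symbol.simps szego_def using that
      by (subst blaschke_plus_center[OF a]) (auto simp: add_divide_distrib)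
    then show ?case using ps by auto
  }
qed

lemma sum_lessThan_offset:
  "(\<Sum>k<offset n N. f k) = (\<Sum>i<N. \<Sum>r<n i. f (r + offset n i))"
proof (induction N)
  case (Suc N)
  have "offset n (Suc N) = offset n N + n N" by (simp add: offset_def)
  then have "(\<Sum>k<offset n (Suc N). f k) = (\<Sum>k<offset n N. f k) + sum f {offset n N..<offset n N + n N}"
    by (simp add: lessThan_atLeast0 sum.atLeastLessThan_concat)
  also have "sum f {offset n N..<offset n N + n N} = (\<Sum>r<n N. f (r + offset n N))"
    using sum.shift_bounds_nat_ivl[of f 0 "offset n N" "n N"] by (simp add: lessThan_atLeast0 add.commute)
  finally show ?case by (simp add: Suc.IH)
qed (simp add: offset_def)

lemma ell2_inner_finite:
  assumes "\<And>k. P \<le> k \<Longrightarrow> h k = 0"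
  shows "ell2_inner h f = (\<Sum>k<P. h k * cnj (f k))"
  unfolding ell2_inner_def using assms by (intro suminf_finite) auto

lemma ell2_norm_sq_finite:
  assumes "\<And>k. P \<le> k \<Longrightarrow> h k = 0"
  shows "(ell2_norm h)\<^sup>2 = (\<Sum>k<P. (cmod (h k))\<^sup>2)"
proof -
  have "(\<Sum>k. (cmod (h k))\<^sup>2) = (\<Sum>k<P. (cmod (h k))\<^sup>2)" using assms by (intro suminf_finite) auto
  then show ?thesis by (simp add: ell2_norm_def sum_nonneg)
qed

text \<open>The analysis operator of the orbit takes \<open>h\<close> to the coefficients of a function in the Hardy
  space; the frame inequalities for \<open>h\<close> are therefore norm inequalities for a combination of
  block symbols.\<close>

lemma orbit_analysis_parseval:
  fixes n :: "nat \<Rightarrow> nat" and z g h :: "nat \<Rightarrow> complex"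
  assumes z: "\<And>i. cmod (z i) < 1" and h: "\<And>k. offset n N \<le> k \<Longrightarrow> h k = 0"
  defines "c \<equiv> \<lambda>i j. g (j + offset n i) / of_real (sqrt (1 - (cmod (z i))\<^sup>2))"
  shows "(\<lambda>k. (cmod (ell2_inner h ((jordan_sum n z ^^ k) g)))\<^sup>2) sums
    circle_sq (\<lambda>w. \<Sum>i<N. \<Sum>r<n i. h (r + offset n i) * block_symbol (c i) (z i) r w)"
proof (rule parseval_circle)
  let ?x = "\<lambda>i r k. cnj ((jordan_sum n z ^^ k) g (r + offset n i))"
  have ps: "summable (\<lambda>k. cmod (?x i r k))"
    "\<And>w. cmod w = 1 \<Longrightarrow> (\<lambda>k. ?x i r k * w ^ k) sums block_symbol (c i) (z i) r w"
    if "r < n i" for i r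
    using orbit_coordinate_power_series[of z i r n g, OF z that] by (auto simp: c_def)
  have inner: "ell2_inner h ((jordan_sum n z ^^ k) g) = (\<Sum>i<N. \<Sum>r<n i. h (r + offset n i) * ?x i r k)" for k
    using ell2_inner_finite[OF h] by (simp add: sum_lessThan_offset)
  show "summable (\<lambda>k. cmod (ell2_inner h ((jordan_sum n z ^^ k) g)))"
  proof (rule summable_comparison_test'[where N = 0])
    show "summable (\<lambda>k. \<Sum>i<N. \<Sum>r<n i. cmod (h (r + offset n i)) * cmod (?x i r k))"
      by (intro summable_sum summable_mult ps) auto
    show "norm (cmod (ell2_inner h ((jordan_sum n z ^^ k) g)))
      \<le> (\<Sum>i<N. \<Sum>r<n i. cmod (h (r + offset n i)) * cmod (?x i r k))" for k
      unfolding inner real_norm_def abs_norm_cancel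
      by (intro order_trans[OF norm_sum] sum_mono) (simp add: norm_mult)
  qed
  fix w :: complex assume w: "cmod w = 1"
  have "(\<lambda>k. \<Sum>i<N. \<Sum>r<n i. h (r + offset n i) * (?x i r k * w ^ k)) sums
     (\<Sum>i<N. \<Sum>r<n i. h (r + offset n i) * block_symbol (c i) (z i) r w)"
    by (intro sums_sum sums_mult ps(2) w) auto
  then show "(\<lambda>k. ell2_inner h ((jordan_sum n z ^^ k) g) * w ^ k) sums
     (\<Sum>i<N. \<Sum>r<n i. h (r + offset n i) * block_symbol (c i) (z i) r w)"
    unfolding inner by (simp add: sum_distrib_right mult.assoc)
qed

section \<open>Triangular structure of block symbols\<close>

text \<open>The coefficients of a block symbol in the orthonormal family \<open>b\<^sup>t k\<close>. They form a triangular
  matrix with constant diagonal \<open>cnj (c 0)\<close>, which is why only \<open>c 0\<close> has to be bounded away from zero.\<close>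

primrec symbol_coeff :: "(nat \<Rightarrow> complex) \<Rightarrow> complex \<Rightarrow> nat \<Rightarrow> nat \<Rightarrow> complex" where
  "symbol_coeff c a 0 t = (if t = 0 then cnj (c 0) else 0)"
| "symbol_coeff c a (Suc r) t
    = (if t = 0 then cnj (c (Suc r)) else symbol_coeff c a r (t - 1)) + a * symbol_coeff c a r t"

lemma symbol_coeff_eq_0: "r < t \<Longrightarrow> symbol_coeff c a r t = 0"
  by (induction r arbitrary: t) auto

lemma symbol_coeff_diag: "symbol_coeff c a r r = cnj (c 0)"
  by (induction r) (auto simp: symbol_coeff_eq_0)

lemma cmod_symbol_coeff_le:
  assumes "\<And>j. j \<le> r \<Longrightarrow> cmod (c j) \<le> C" "cmod a < 1"
  shows "cmod (symbol_coeff c a r t) \<le> C * 2 ^ r"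
  using assms(1)
proof (induction r arbitrary: t)
  case 0
  have "0 \<le> C" using 0[of 0] norm_ge_zero order_trans by blast
  then show ?case using 0 by simp
next
  case (Suc r)
  have IH: "cmod (symbol_coeff c a r t) \<le> C * 2 ^ r" for t using Suc by auto
  have C0: "0 \<le> C" using Suc.prems[of 0] norm_ge_zero order_trans by blast
  then have "C * 1 \<le> C * 2 ^ r" by (intro mult_left_mono) auto
  then have 1: "cmod (if t = 0 then cnj (c (Suc r)) else symbol_coeff c a r (t - 1)) \<le> C * 2 ^ r"
    using IH[of "t - 1"] Suc.prems[of "Suc r"] by auto
  have "cmod (a * symbol_coeff c a r t) \<le> 1 * (C * 2 ^ r)"
    unfolding norm_mult using assms(2) IH by (intro mult_mono) auto
  then show ?case using norm_triangle_mono[OF 1] by fastforce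
qed

lemma block_symbol_eq:
  assumes "r < m"
  shows "block_symbol c a r w = (\<Sum>t<m. symbol_coeff c a r t * (blaschke a w ^ t * szego a w))"
  using assms
proof (induction r)
  case 0
  then show ?case by (simp add: if_distrib[of "\<lambda>x. x * _"] cong: if_cong)
next
  case (Suc r)
  then obtain m' where m: "m = Suc m'" by (cases m) auto
  let ?e = "\<lambda>t. blaschke a w ^ t * szego a w" and ?s = "symbol_coeff c a r"
  have IH: "block_symbol c a r w = (\<Sum>t<m. ?s t * ?e t)" using Suc by simp
  have IH': "block_symbol c a r w = (\<Sum>t<m'. ?s t * ?e t)"
    using IH Suc.prems symbol_coeff_eq_0[of r m' c a] by (simp add: m)
  have "(\<Sum>t<m. symbol_coeff c a (Suc r) t * ?e t)
     = (\<Sum>t<m. (if t = 0 then cnj (c (Suc r)) else ?s (t - 1)) * ?e t) + a * (\<Sum>t<m. ?s t * ?e t)"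
    by (simp add: distrib_right sum.distrib sum_distrib_left mult.assoc)
  also have "(\<Sum>t<m. (if t = 0 then cnj (c (Suc r)) else ?s (t - 1)) * ?e t)
     = cnj (c (Suc r)) * szego a w + blaschke a w * (\<Sum>t<m'. ?s t * ?e t)"
    unfolding m sum.lessThan_Suc_shift by (simp add: sum_distrib_left mult_ac)
  finally show ?case by (simp only: block_symbol.simps IH[symmetric] IH'[symmetric]) (simp add: algebra_simps)
qed

text \<open>Back substitution: solving row \<open>t\<close> for \<open>\<eta> t\<close> enlarges the sum of \<open>D\<close> and the moduli of
  the unknowns found so far by at most the factor \<open>1 + 1 / \<kappa> + K / \<kappa>\<close>.\<close>

lemma triangular_system_bound:
  fixes \<eta> :: "nat \<Rightarrow> complex" and \<mu> :: "nat \<Rightarrow> nat \<Rightarrow> complex"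
  assumes \<kappa>: "0 < \<kappa>" "\<And>t. t < m \<Longrightarrow> \<kappa> \<le> cmod (\<mu> t t)"
    and K: "0 \<le> K" "\<And>r t. r < m \<Longrightarrow> cmod (\<mu> r t) \<le> K"
    and D: "0 \<le> D" "\<And>t. t < m \<Longrightarrow> cmod (\<Sum>r=t..<m. \<eta> r * \<mu> r t) \<le> D"
  shows "(\<Sum>r<m. cmod (\<eta> r)) \<le> (1 + 1 / \<kappa> + K / \<kappa>) ^ m * D"
proof -
  define L where "L = 1 + 1 / \<kappa> + K / \<kappa>"
  define T where "T t = (\<Sum>r=t..<m. cmod (\<eta> r))" for t
  have T0: "0 \<le> T t" for t by (simp add: T_def sum_nonneg)
  have "D + T t \<le> L ^ (m - t) * D" if "t \<le> m" for t
    using that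
  proof (induction rule: inc_induct)
    case base
    then show ?case by (simp add: T_def)
  next
    case (step t)
    have split: "{t..<m} = insert t {Suc t..<m}" using step by auto
    have Tt: "T t = cmod (\<eta> t) + T (Suc t)" by (simp add: T_def split)
    have "cmod (\<eta> t) * \<kappa> \<le> cmod (\<eta> t * \<mu> t t)"
      unfolding norm_mult using \<kappa>(2)[OF step(2)] by (intro mult_left_mono) auto
    also have "\<eta> t * \<mu> t t = (\<Sum>r=t..<m. \<eta> r * \<mu> r t) - (\<Sum>r=Suc t..<m. \<eta> r * \<mu> r t)"
      by (simp add: split)
    also have "cmod \<dots> \<le> D + K * T (Suc t)"
    proof (rule order_trans[OF norm_triangle_ineq4], rule add_mono)
      show "cmod (\<Sum>r=t..<m. \<eta> r * \<mu> r t) \<le> D" by (rule D(2)[OF step(2)])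
      have "cmod (\<Sum>r=Suc t..<m. \<eta> r * \<mu> r t) \<le> (\<Sum>r=Suc t..<m. K * cmod (\<eta> r))"
      proof (rule order_trans[OF norm_sum], rule sum_mono)
        fix r assume "r \<in> {Suc t..<m}"
        then have "cmod (\<eta> r) * cmod (\<mu> r t) \<le> cmod (\<eta> r) * K" by (intro mult_left_mono K) auto
        then show "cmod (\<eta> r * \<mu> r t) \<le> K * cmod (\<eta> r)" by (simp add: norm_mult mult.commute)
      qed
      then show "cmod (\<Sum>r=Suc t..<m. \<eta> r * \<mu> r t) \<le> K * T (Suc t)" by (simp add: T_def sum_distrib_left)
    qed
    finally have "cmod (\<eta> t) \<le> 1 / \<kappa> * D + K / \<kappa> * T (Suc t)"
      using \<kappa>(1) by (simp add: field_simps)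
    then have "D + T t \<le> (1 + 1 / \<kappa>) * D + (1 + K / \<kappa>) * T (Suc t)" unfolding Tt by (simp add: algebra_simps)
    also have "\<dots> \<le> L * D + L * T (Suc t)"
      using D(1) T0 \<kappa>(1) K(1) by (intro add_mono mult_right_mono) (auto simp: L_def)
    also have "\<dots> = L * (D + T (Suc t))" by (simp add: algebra_simps)
    also have "\<dots> \<le> L * (L ^ (m - Suc t) * D)"
      using step \<kappa>(1) K(1) by (intro mult_left_mono) (auto simp: L_def)
    also have "\<dots> = L ^ (m - t) * D" using step by (simp add: Suc_diff_Suc flip: mult.assoc power_Suc)
    finally show ?case .
  qed
  from this[of 0] show ?thesis using D(1) by (simp add: T_def L_def lessThan_atLeast0)
qed

text \<open>Between the blocks the estimate is \<open>blaschke_blocks_riesz\<close>; within a block the symbols arise from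
  the orthonormal family by a triangular matrix, which is bounded with a bounded inverse. All
  constants are independent of the number \<open>N\<close> of blocks.\<close>

lemma block_symbols_riesz:
  assumes \<delta>: "0 < \<delta>" "\<delta> \<le> 1" and m: "0 < m" and \<kappa>: "0 < \<kappa>" and C: "0 \<le> C"
  shows "\<exists>A>0. \<exists>B. \<forall>N (n :: nat \<Rightarrow> nat) (z :: nat \<Rightarrow> complex) c \<eta>.
      (\<forall>i. n i \<le> m) \<longrightarrow> (\<forall>i. cmod (z i) < 1) \<longrightarrow>
      (\<forall>j. \<delta> \<le> (\<Prod>k\<in>{..<N} - {j}. cmod (blaschke (z k) (z j)))) \<longrightarrow>
      (\<forall>i. \<kappa> \<le> cmod (c i 0)) \<longrightarrow> (\<forall>i j. j < n i \<longrightarrow> cmod (c i j) \<le> C) \<longrightarrow>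
      A * (\<Sum>i<N. \<Sum>r<n i. (cmod (\<eta> i r))\<^sup>2)
        \<le> circle_sq (\<lambda>w. \<Sum>i<N. \<Sum>r<n i. \<eta> i r * block_symbol (c i) (z i) r w) \<and>
      circle_sq (\<lambda>w. \<Sum>i<N. \<Sum>r<n i. \<eta> i r * block_symbol (c i) (z i) r w)
        \<le> B * (\<Sum>i<N. \<Sum>r<n i. (cmod (\<eta> i r))\<^sup>2)"
proof -
  obtain M where M: "0 < M"
    "\<forall>S (z :: nat \<Rightarrow> complex) d. finite S \<longrightarrow> (\<forall>i\<in>S. cmod (z i) < 1) \<longrightarrow>
      (\<forall>j\<in>S. \<delta> \<le> (\<Prod>k\<in>S - {j}. cmod (blaschke (z k) (z j)))) \<longrightarrow>
      (\<Sum>i\<in>S. \<Sum>t<m. (cmod (d i t))\<^sup>2)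
        \<le> M * circle_sq (\<lambda>w. \<Sum>i\<in>S. \<Sum>t<m. d i t * (blaschke (z i) w ^ t * szego (z i) w)) \<and>
      circle_sq (\<lambda>w. \<Sum>i\<in>S. \<Sum>t<m. d i t * (blaschke (z i) w ^ t * szego (z i) w))
        \<le> M * (\<Sum>i\<in>S. \<Sum>t<m. (cmod (d i t))\<^sup>2)"
    using blaschke_blocks_riesz[OF \<delta> m] by (elim exE conjE)
  define K where "K = C * 2 ^ m"
  have K0: "0 \<le> K" using C by (simp add: K_def)
  define L where "L = 1 + 1 / \<kappa> + K / \<kappa>"
  have L1: "1 \<le> L" using \<kappa> K0 by (simp add: L_def)
  define P where "P = (L ^ m)\<^sup>2"
  have P0: "0 < P" using L1 by (simp add: P_def)
  show ?thesis
  proof (rule exI[of _ "1 / (P * M)"], rule conjI, use P0 M(1) in simp,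
      rule exI[of _ "M * (real m * (K\<^sup>2 * real m))"], intro allI impI)
    fix N and n :: "nat \<Rightarrow> nat" and z :: "nat \<Rightarrow> complex" and c \<eta> :: "nat \<Rightarrow> nat \<Rightarrow> complex"
    assume "\<forall>i. n i \<le> m" "\<forall>i. cmod (z i) < 1"
      and sep: "\<forall>j. \<delta> \<le> (\<Prod>k\<in>{..<N} - {j}. cmod (blaschke (z k) (z j)))"
      and "\<forall>i. \<kappa> \<le> cmod (c i 0)" "\<forall>i j. j < n i \<longrightarrow> cmod (c i j) \<le> C"
    then have n: "\<And>i. n i \<le> m" and z: "\<And>i. cmod (z i) < 1"
      and c0: "\<And>i. \<kappa> \<le> cmod (c i 0)" and cC: "\<And>i j. j < n i \<Longrightarrow> cmod (c i j) \<le> C" by simp_all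
    define \<mu> where "\<mu> i = symbol_coeff (c i) (z i)" for i
    define d where "d i t = (\<Sum>r<n i. \<eta> i r * \<mu> i r t)" for i t
    have \<mu>K: "cmod (\<mu> i r t) \<le> K" if "r < n i" for i r t
    proof -
      have "cmod (\<mu> i r t) \<le> C * 2 ^ r"
        unfolding \<mu>_def using that by (intro cmod_symbol_coeff_le cC z) auto
      also have "\<dots> \<le> K"
        unfolding K_def using that n[of i] C by (intro mult_left_mono power_increasing) auto
      finally show ?thesis .
    qed
    have sym: "(\<Sum>r<n i. \<eta> i r * block_symbol (c i) (z i) r w)
       = (\<Sum>t<m. d i t * (blaschke (z i) w ^ t * szego (z i) w))" for i w
    proof -
      have "(\<Sum>r<n i. \<eta> i r * block_symbol (c i) (z i) r w)
        = (\<Sum>r<n i. \<Sum>t<m. \<eta> i r * \<mu> i r t * (blaschke (z i) w ^ t * szego (z i) w))"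
        using n[of i] by (intro sum.cong refl) (simp add: block_symbol_eq[of _ m] \<mu>_def sum_distrib_left mult.assoc)
      also have "\<dots> = (\<Sum>t<m. d i t * (blaschke (z i) w ^ t * szego (z i) w))"
        unfolding d_def sum_distrib_right by (rule sum.swap)
      finally show ?thesis .
    qed
    have up: "(\<Sum>t<m. (cmod (d i t))\<^sup>2) \<le> (real m * (K\<^sup>2 * real m)) * (\<Sum>r<n i. (cmod (\<eta> i r))\<^sup>2)" for i
    proof -
      have "(cmod (d i t))\<^sup>2 \<le> K\<^sup>2 * real m * (\<Sum>r<n i. (cmod (\<eta> i r))\<^sup>2)" for t
      proof -
        have "cmod (d i t) \<le> (\<Sum>r<n i. K * cmod (\<eta> i r))"
          unfolding d_def
        proof (rule order_trans[OF norm_sum], rule sum_mono)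
          fix r assume "r \<in> {..<n i}"
          then have "cmod (\<eta> i r) * cmod (\<mu> i r t) \<le> cmod (\<eta> i r) * K" by (intro mult_left_mono \<mu>K) auto
          then show "cmod (\<eta> i r * \<mu> i r t) \<le> K * cmod (\<eta> i r)" by (simp add: norm_mult mult.commute)
        qed
        then have "(cmod (d i t))\<^sup>2 \<le> (K * (\<Sum>r<n i. cmod (\<eta> i r)))\<^sup>2"
          unfolding sum_distrib_left by (intro power_mono) auto
        also have "\<dots> = K\<^sup>2 * (\<Sum>r<n i. cmod (\<eta> i r))\<^sup>2" by (simp add: power_mult_distrib)
        also have "\<dots> \<le> K\<^sup>2 * ((\<Sum>r<n i. (cmod (\<eta> i r))\<^sup>2) * real (card {..<n i}))"
          by (intro mult_left_mono sum_squared_le_sum_of_squares) auto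
        also have "\<dots> \<le> K\<^sup>2 * ((\<Sum>r<n i. (cmod (\<eta> i r))\<^sup>2) * real m)"
          using n[of i] by (intro mult_left_mono) (auto simp: sum_nonneg)
        finally show ?thesis by (simp add: mult_ac)
      qed
      then have "(\<Sum>t<m. (cmod (d i t))\<^sup>2) \<le> (\<Sum>t<m. K\<^sup>2 * real m * (\<Sum>r<n i. (cmod (\<eta> i r))\<^sup>2))"
        by (rule sum_mono)
      then show ?thesis by (simp add: mult_ac)
    qed
    have low: "(\<Sum>r<n i. (cmod (\<eta> i r))\<^sup>2) \<le> P * (\<Sum>t<m. (cmod (d i t))\<^sup>2)" for i
    proof -
      define D where "D = sqrt (\<Sum>t<m. (cmod (d i t))\<^sup>2)"
      have D0: "0 \<le> D" by (simp add: D_def sum_nonneg)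
      have dD: "cmod (\<Sum>r=t..<n i. \<eta> i r * \<mu> i r t) \<le> D" if t: "t < n i" for t
      proof -
        have "(\<Sum>r=t..<n i. \<eta> i r * \<mu> i r t) = d i t"
          unfolding d_def \<mu>_def using symbol_coeff_eq_0 by (intro sum.mono_neutral_left) auto
        moreover have "cmod (d i t) \<le> D"
          unfolding D_def using t n[of i] by (intro real_le_rsqrt member_le_sum) auto
        ultimately show ?thesis by simp
      qed
      have "(\<Sum>r<n i. cmod (\<eta> i r)) \<le> L ^ n i * D"
        unfolding L_def using c0 \<mu>K dD D0 K0 \<kappa>
        by (intro triangular_system_bound[where \<mu> = "\<mu> i"]) (auto simp: \<mu>_def symbol_coeff_diag)
      also have "\<dots> \<le> L ^ m * D"
        using L1 n[of i] D0 by (intro mult_right_mono power_increasing) auto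
      finally have 1: "(\<Sum>r<n i. cmod (\<eta> i r)) \<le> L ^ m * D" .
      have "sqrt (\<Sum>r<n i. (cmod (\<eta> i r))\<^sup>2) \<le> (\<Sum>r<n i. cmod (\<eta> i r))"
        using L2_set_le_sum[of "{..<n i}" "\<lambda>r. cmod (\<eta> i r)"] by (simp add: L2_set_def)
      then have "(sqrt (\<Sum>r<n i. (cmod (\<eta> i r))\<^sup>2))\<^sup>2 \<le> (L ^ m * D)\<^sup>2"
        using 1 by (intro power_mono) (auto simp: sum_nonneg)
      then show ?thesis by (simp add: P_def D_def power_mult_distrib sum_nonneg)
    qed
    define Q where "Q = circle_sq (\<lambda>w. \<Sum>i<N. \<Sum>r<n i. \<eta> i r * block_symbol (c i) (z i) r w)"
    have r: "(\<Sum>i<N. \<Sum>t<m. (cmod (d i t))\<^sup>2) \<le> M * Q" "Q \<le> M * (\<Sum>i<N. \<Sum>t<m. (cmod (d i t))\<^sup>2)"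
      using M(2)[rule_format, of "{..<N}" z d] z sep unfolding Q_def sym by auto
    have "(\<Sum>i<N. \<Sum>r<n i. (cmod (\<eta> i r))\<^sup>2) \<le> P * (\<Sum>i<N. \<Sum>t<m. (cmod (d i t))\<^sup>2)"
      unfolding sum_distrib_left using low by (intro sum_mono) (simp add: sum_distrib_left)
    also have "\<dots> \<le> P * (M * Q)" using r(1) P0 by (intro mult_left_mono) auto
    finally have 1: "1 / (P * M) * (\<Sum>i<N. \<Sum>r<n i. (cmod (\<eta> i r))\<^sup>2) \<le> Q"
      using P0 M(1) by (simp add: divide_le_eq mult_ac)
    have "(\<Sum>i<N. \<Sum>t<m. (cmod (d i t))\<^sup>2) \<le> (real m * (K\<^sup>2 * real m)) * (\<Sum>i<N. \<Sum>r<n i. (cmod (\<eta> i r))\<^sup>2)"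
      unfolding sum_distrib_left[of _ _ "{..<N}"] by (intro sum_mono up)
    then have "M * (\<Sum>i<N. \<Sum>t<m. (cmod (d i t))\<^sup>2) \<le> M * ((real m * (K\<^sup>2 * real m)) * (\<Sum>i<N. \<Sum>r<n i. (cmod (\<eta> i r))\<^sup>2))"
      using M(1) by (intro mult_left_mono) auto
    then have "Q \<le> M * (real m * (K\<^sup>2 * real m)) * (\<Sum>i<N. \<Sum>r<n i. (cmod (\<eta> i r))\<^sup>2)"
      using r(2) by (simp only: mult.assoc order_trans)
    with 1 show "1 / (P * M) * (\<Sum>i<N. \<Sum>r<n i. (cmod (\<eta> i r))\<^sup>2)
        \<le> circle_sq (\<lambda>w. \<Sum>i<N. \<Sum>r<n i. \<eta> i r * block_symbol (c i) (z i) r w) \<and>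
      circle_sq (\<lambda>w. \<Sum>i<N. \<Sum>r<n i. \<eta> i r * block_symbol (c i) (z i) r w)
        \<le> M * (real m * (K\<^sup>2 * real m)) * (\<Sum>i<N. \<Sum>r<n i. (cmod (\<eta> i r))\<^sup>2)"
      unfolding Q_def by blast
  qed
qed

section \<open>Frames and finitely supported vectors\<close>

lemma ell2_norm_sq: "h \<in> ell2 \<Longrightarrow> (ell2_norm h)\<^sup>2 = (\<Sum>k. (cmod (h k))\<^sup>2)"
  by (simp add: ell2_norm_def ell2_def suminf_nonneg)

lemma ell2_inner_sums:
  assumes "h \<in> ell2" "f \<in> ell2"
  shows "(\<lambda>k. h k * cnj (f k)) sums ell2_inner h f"
proof -
  have "summable (\<lambda>k. cmod (h k * cnj (f k)))"
  proof (rule summable_comparison_test'[where N = 0])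
    show "summable (\<lambda>k. (cmod (h k))\<^sup>2 + (cmod (f k))\<^sup>2)"
      using assms by (intro summable_add) (auto simp: ell2_def)
    fix k
    have "2 * (cmod (h k) * cmod (f k)) \<le> (cmod (h k))\<^sup>2 + (cmod (f k))\<^sup>2"
      using sum_squares_bound[of "cmod (h k)" "cmod (f k)"] by simp
    moreover have "0 \<le> cmod (h k) * cmod (f k)" by simp
    ultimately have "cmod (h k) * cmod (f k) \<le> (cmod (h k))\<^sup>2 + (cmod (f k))\<^sup>2" by linarith
    then show "norm (cmod (h k * cnj (f k))) \<le> (cmod (h k))\<^sup>2 + (cmod (f k))\<^sup>2"
      by (simp add: norm_mult)
  qed
  then show ?thesis unfolding ell2_inner_def by (intro summable_sums) (rule summable_norm_cancel)
qed

lemma ell2_tail: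
  assumes h: "h \<in> ell2"
  shows "(\<lambda>k. if k < P then 0 else h k) \<in> ell2"
    and "(ell2_norm (\<lambda>k. if k < P then 0 else h k))\<^sup>2 = (ell2_norm h)\<^sup>2 - (\<Sum>k<P. (cmod (h k))\<^sup>2)"
proof -
  have "(\<lambda>k. (cmod (h k))\<^sup>2) sums (ell2_norm h)\<^sup>2"
    using h by (simp add: ell2_norm_sq ell2_def summable_sums)
  moreover have "(\<lambda>k. if k \<in> {..<P} then (cmod (h k))\<^sup>2 else 0) sums (\<Sum>k<P. (cmod (h k))\<^sup>2)"
    by (rule sums_If_finite_set) simp
  ultimately have "(\<lambda>k. (cmod (h k))\<^sup>2 - (if k \<in> {..<P} then (cmod (h k))\<^sup>2 else 0)) sums
      ((ell2_norm h)\<^sup>2 - (\<Sum>k<P. (cmod (h k))\<^sup>2))" by (rule sums_diff)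
  moreover have "(\<lambda>k. (cmod (h k))\<^sup>2 - (if k \<in> {..<P} then (cmod (h k))\<^sup>2 else 0))
    = (\<lambda>k. (cmod (if k < P then 0 else h k))\<^sup>2)" by auto
  ultimately have s: "(\<lambda>k. (cmod (if k < P then 0 else h k))\<^sup>2) sums ((ell2_norm h)\<^sup>2 - (\<Sum>k<P. (cmod (h k))\<^sup>2))"
    by simp
  then show t: "(\<lambda>k. if k < P then 0 else h k) \<in> ell2" unfolding ell2_def by (auto simp: summable_def)
  show "(ell2_norm (\<lambda>k. if k < P then 0 else h k))\<^sup>2 = (ell2_norm h)\<^sup>2 - (\<Sum>k<P. (cmod (h k))\<^sup>2)"
    unfolding ell2_norm_sq[OF t] using s by (rule sums_unique[symmetric])
qed

lemma ell2_tail_tendsto_0: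
  assumes h: "h \<in> ell2" and p: "filterlim p at_top sequentially"
  shows "(\<lambda>N. (ell2_norm (\<lambda>k. if k < p N then 0 else h k))\<^sup>2) \<longlonglongrightarrow> 0"
proof -
  have "(\<lambda>P. \<Sum>k<P. (cmod (h k))\<^sup>2) \<longlonglongrightarrow> (ell2_norm h)\<^sup>2"
    using h by (simp add: ell2_norm_sq ell2_def summable_LIMSEQ)
  then have "(\<lambda>N. \<Sum>k<p N. (cmod (h k))\<^sup>2) \<longlonglongrightarrow> (ell2_norm h)\<^sup>2" by (rule filterlim_compose[OF _ p])
  then have "(\<lambda>N. (ell2_norm h)\<^sup>2 - (\<Sum>k<p N. (cmod (h k))\<^sup>2)) \<longlonglongrightarrow> (ell2_norm h)\<^sup>2 - (ell2_norm h)\<^sup>2"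
    by (intro tendsto_intros)
  then show ?thesis by (simp add: ell2_tail(2)[OF h])
qed

text \<open>For general \<open>h\<close> the upper bound passes to the limit of truncations on every finite set of
  indices \<open>k\<close>. The lower bound is applied to the truncation, and the upper one to the remaining
  tail, whose norm tends to zero; splitting the square of a sum costs a factor two in \<open>A\<close>.\<close>

lemma ell2_frame_from_finite_support:
  fixes F :: "nat \<Rightarrow> nat \<Rightarrow> complex" and p :: "nat \<Rightarrow> nat"
  assumes F: "\<And>k. F k \<in> ell2" and A: "0 < A" and p: "filterlim p at_top sequentially"
    and sm: "\<And>h N. (\<And>k. p N \<le> k \<Longrightarrow> h k = 0) \<Longrightarrow> summable (\<lambda>k. (cmod (ell2_inner h (F k)))\<^sup>2)"
    and lower: "\<And>h N. (\<And>k. p N \<le> k \<Longrightarrow> h k = 0) \<Longrightarrow>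
      A * (ell2_norm h)\<^sup>2 \<le> (\<Sum>k. (cmod (ell2_inner h (F k)))\<^sup>2)"
    and upper: "\<And>h N. (\<And>k. p N \<le> k \<Longrightarrow> h k = 0) \<Longrightarrow>
      (\<Sum>k. (cmod (ell2_inner h (F k)))\<^sup>2) \<le> B * (ell2_norm h)\<^sup>2"
  shows "ell2_frame F"
proof -
  define B' where "B' = max A B"
  have B0: "0 \<le> B'" using A by (simp add: B'_def)
  define T where "T h N = (\<lambda>k. if k < p N then h k else 0 :: complex)" for h :: "nat \<Rightarrow> complex" and N
  define R where "R h N = (\<lambda>k. if k < p N then 0 else h k :: complex)" for h :: "nat \<Rightarrow> complex" and N
  have T0: "T h N k = 0" if "p N \<le> k" for h N k using that by (simp add: T_def)
  have normT: "(ell2_norm (T h N))\<^sup>2 = (\<Sum>k<p N. (cmod (h k))\<^sup>2)" for h N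
    by (subst ell2_norm_sq_finite[of "p N", OF T0], assumption) (simp add: T_def)
  have normT': "(ell2_norm (T h N))\<^sup>2 = (ell2_norm h)\<^sup>2 - (ell2_norm (R h N))\<^sup>2" if "h \<in> ell2" for h N
    unfolding normT R_def ell2_tail(2)[OF that] by simp
  have innerT: "ell2_inner (T h N) f = (\<Sum>k<p N. h k * cnj (f k))" for h N f
    by (subst ell2_inner_finite[of "p N", OF T0], assumption) (simp add: T_def)
  have upT: "(\<Sum>k. (cmod (ell2_inner (T h N) (F k)))\<^sup>2) \<le> B' * (ell2_norm (T h N))\<^sup>2" for h N
    by (rule order_trans[OF upper[of N, OF T0]]) (auto intro!: mult_right_mono simp: B'_def)
  have bessel: "summable (\<lambda>k. (cmod (ell2_inner h (F k)))\<^sup>2) \<and>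
      (\<Sum>k. (cmod (ell2_inner h (F k)))\<^sup>2) \<le> B' * (ell2_norm h)\<^sup>2" if h: "h \<in> ell2" for h
  proof -
    have lim: "(\<lambda>N. ell2_inner (T h N) (F k)) \<longlonglongrightarrow> ell2_inner h (F k)" for k
      unfolding innerT using ell2_inner_sums[OF h F] p unfolding sums_def by (rule filterlim_compose)
    have part: "(\<Sum>k<K. (cmod (ell2_inner h (F k)))\<^sup>2) \<le> B' * (ell2_norm h)\<^sup>2" for K
    proof (rule LIMSEQ_le_const2)
      show "(\<lambda>N. \<Sum>k<K. (cmod (ell2_inner (T h N) (F k)))\<^sup>2) \<longlonglongrightarrow> (\<Sum>k<K. (cmod (ell2_inner h (F k)))\<^sup>2)"
        by (intro tendsto_intros lim)
      have "(\<Sum>k<K. (cmod (ell2_inner (T h N) (F k)))\<^sup>2) \<le> B' * (ell2_norm h)\<^sup>2" for N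
      proof -
        have "(\<Sum>k<K. (cmod (ell2_inner (T h N) (F k)))\<^sup>2) \<le> (\<Sum>k. (cmod (ell2_inner (T h N) (F k)))\<^sup>2)"
          by (intro sum_le_suminf sm[of N] T0) auto
        also have "\<dots> \<le> B' * (ell2_norm (T h N))\<^sup>2" by (rule upT)
        also have "\<dots> \<le> B' * (ell2_norm h)\<^sup>2"
          unfolding normT'[OF h] using B0 by (intro mult_left_mono) auto
        finally show ?thesis .
      qed
      then show "\<exists>M. \<forall>N\<ge>M. (\<Sum>k<K. (cmod (ell2_inner (T h N) (F k)))\<^sup>2) \<le> B' * (ell2_norm h)\<^sup>2" by blast
    qed
    have s: "summable (\<lambda>k. (cmod (ell2_inner h (F k)))\<^sup>2)"
      by (rule bounded_imp_summable[OF _ part[of "Suc _", unfolded lessThan_Suc_atMost]]) simp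
    then show ?thesis using part by (auto intro: suminf_le_const)
  qed
  have low: "A / 2 * (ell2_norm h)\<^sup>2 \<le> (\<Sum>k. (cmod (ell2_inner h (F k)))\<^sup>2)" if h: "h \<in> ell2" for h
  proof -
    have R: "R h N \<in> ell2" for N unfolding R_def by (rule ell2_tail[OF h])
    let ?S = "\<Sum>k. (cmod (ell2_inner h (F k)))\<^sup>2"
    have le: "A * ((ell2_norm h)\<^sup>2 - (ell2_norm (R h N))\<^sup>2) \<le> 2 * ?S + 2 * (B' * (ell2_norm (R h N))\<^sup>2)" for N
    proof -
      have pt: "(cmod (ell2_inner (T h N) (F k)))\<^sup>2
          \<le> 2 * (cmod (ell2_inner h (F k)))\<^sup>2 + 2 * (cmod (ell2_inner (R h N) (F k)))\<^sup>2" for k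
      proof -
        have "T h N \<in> ell2" unfolding ell2_def
          by (auto intro!: summable_finite[of "{..<p N}"] T0)
        then have "(\<lambda>l. T h N l * cnj (F k l) + R h N l * cnj (F k l)) sums
            (ell2_inner (T h N) (F k) + ell2_inner (R h N) (F k))"
          by (intro sums_add ell2_inner_sums F R)
        moreover have "(\<lambda>l. T h N l * cnj (F k l) + R h N l * cnj (F k l)) = (\<lambda>l. h l * cnj (F k l))"
          by (auto simp: T_def R_def)
        ultimately have "ell2_inner h (F k) = ell2_inner (T h N) (F k) + ell2_inner (R h N) (F k)"
          using sums_unique2[OF ell2_inner_sums[OF h F]] by metis
        then have "cmod (ell2_inner (T h N) (F k)) \<le> cmod (ell2_inner h (F k)) + cmod (ell2_inner (R h N) (F k))"
          using norm_triangle_ineq4[of "ell2_inner h (F k)" "ell2_inner (R h N) (F k)"] by simp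
        then have "(cmod (ell2_inner (T h N) (F k)))\<^sup>2 \<le> (cmod (ell2_inner h (F k)) + cmod (ell2_inner (R h N) (F k)))\<^sup>2"
          by (intro power_mono) auto
        also have "\<dots> \<le> 2 * (cmod (ell2_inner h (F k)))\<^sup>2 + 2 * (cmod (ell2_inner (R h N) (F k)))\<^sup>2"
          using sum_squares_bound[of "cmod (ell2_inner h (F k))" "cmod (ell2_inner (R h N) (F k))"]
          by (simp add: power2_sum)
        finally show ?thesis .
      qed
      note bh = bessel[OF h] and bR = bessel[OF R[of N]]
      have "A * ((ell2_norm h)\<^sup>2 - (ell2_norm (R h N))\<^sup>2) = A * (ell2_norm (T h N))\<^sup>2"
        by (simp add: normT'[OF h])
      also have "\<dots> \<le> (\<Sum>k. (cmod (ell2_inner (T h N) (F k)))\<^sup>2)" by (intro lower[of N] T0)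
      also have "\<dots> \<le> (\<Sum>k. 2 * (cmod (ell2_inner h (F k)))\<^sup>2 + 2 * (cmod (ell2_inner (R h N) (F k)))\<^sup>2)"
        using bh bR by (intro suminf_le[OF pt sm[of N, OF T0]] summable_add summable_mult) auto
      also have "\<dots> = 2 * ?S + 2 * (\<Sum>k. (cmod (ell2_inner (R h N) (F k)))\<^sup>2)"
        using bh bR by (subst suminf_add[symmetric]) (auto intro!: summable_mult simp: suminf_mult)
      also have "\<dots> \<le> 2 * ?S + 2 * (B' * (ell2_norm (R h N))\<^sup>2)" using bR by simp
      finally show ?thesis .
    qed
    have R0: "(\<lambda>N. (ell2_norm (R h N))\<^sup>2) \<longlonglongrightarrow> 0" unfolding R_def by (rule ell2_tail_tendsto_0[OF h p])
    have "A * ((ell2_norm h)\<^sup>2 - 0) \<le> 2 * ?S + 2 * (B' * 0)"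
      by (rule LIMSEQ_le[of "\<lambda>N. A * ((ell2_norm h)\<^sup>2 - (ell2_norm (R h N))\<^sup>2)" _
           "\<lambda>N. 2 * ?S + 2 * (B' * (ell2_norm (R h N))\<^sup>2)"])
         (intro tendsto_intros R0, intro tendsto_intros R0, use le in blast)
    then show ?thesis by simp
  qed
  show ?thesis unfolding ell2_frame_def
    by (intro conjI allI F exI[of _ "A / 2"] exI[of _ B'] ballI)
       (use A low bessel in \<open>auto simp: B'_def\<close>)
qed

section \<open>Carleson sequences and block expansions\<close>

lemma cmod_blaschke_le_1:
  assumes "cmod a < 1" "cmod w < 1"
  shows "cmod (blaschke a w) \<le> 1"
proof -
  have "0 \<le> 1 - (cmod (blaschke a w))\<^sup>2"
    using one_minus_cmod_sq_pos[OF assms(1)] one_minus_cmod_sq_pos[OF assms(2)] assms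
    by (subst blaschke_defect) auto
  then show ?thesis using power_le_one_iff[of "cmod (blaschke a w)" 2] by simp
qed

text \<open>For points of the disc the partial products decrease in \<open>N\<close>, so their limits exist and a
  lower bound for the limits is the same as one for all partial products.\<close>

lemma carleson_sequence_iff:
  "carleson_sequence z \<longleftrightarrow> (\<forall>i. cmod (z i) < 1) \<and>
    (\<exists>\<delta>>0. \<forall>k N. \<delta> \<le> (\<Prod>j\<in>{..<N} - {k}. cmod (blaschke (z j) (z k))))"
proof (cases "\<forall>i. cmod (z i) < 1")
  case True
  define p where "p k N = (\<Prod>j\<in>{..<N} - {k}. cmod (blaschke (z j) (z k)))" for k N
  have p0: "0 \<le> p k N" for k N by (simp add: p_def prod_nonneg)
  have dec: "decseq (p k)" for k
  proof (rule decseq_SucI)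
    fix N
    have "{..<Suc N} - {k} = (if N = k then {..<N} - {k} else insert N ({..<N} - {k}))" by auto
    then show "p k (Suc N) \<le> p k N"
      using cmod_blaschke_le_1[of "z N" "z k"] True p0[of k N]
      by (auto simp: p_def intro!: mult_left_le_one_le)
  qed
  have conv: "p k \<longlonglongrightarrow> lim (p k)" for k
  proof -
    have "Bseq (p k)"
      by (rule decseq_bounded[OF dec]) (use p0 in blast)
    then show ?thesis using dec Bseq_monoseq_convergent convergent_LIMSEQ_iff decseq_imp_monoseq by blast
  qed
  have lim_le: "lim (p k) \<le> p k N" for k N by (rule decseq_ge[OF dec conv])
  have lim_ge: "x \<le> lim (p k)" if "\<And>N. x \<le> p k N" for x k
    by (rule LIMSEQ_le_const[OF conv]) (use that in blast)
  have "cmod ((z j - z k) / (1 - cnj (z j) * z k)) = cmod (blaschke (z j) (z k))" for j k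
    by (simp add: blaschke_def norm_divide norm_minus_commute)
  then have "carleson_sequence z \<longleftrightarrow> 0 < (INF k. lim (p k))"
    using True by (auto simp: carleson_sequence_def p_def[abs_def])
  also have "\<dots> \<longleftrightarrow> (\<exists>\<delta>>0. \<forall>k N. \<delta> \<le> p k N)"
  proof
    assume pos: "0 < (INF k. lim (p k))"
    have "(INF k. lim (p k)) \<le> p k N" for k N
    proof -
      have "bdd_below (range (\<lambda>k. lim (p k)))" using lim_ge[OF p0] by (auto simp: bdd_below_def)
      then have "(INF k. lim (p k)) \<le> lim (p k)" by (rule cINF_lower) simp
      then show ?thesis using lim_le by (rule order_trans)
    qed
    then show "\<exists>\<delta>>0. \<forall>k N. \<delta> \<le> p k N" using pos by blast
  next
    assume "\<exists>\<delta>>0. \<forall>k N. \<delta> \<le> p k N"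
    then obtain \<delta> where \<delta>: "\<delta> > 0" "\<And>k N. \<delta> \<le> p k N" by blast
    have "\<delta> \<le> (INF k. lim (p k))" by (rule cINF_greatest) (auto intro: lim_ge \<delta>)
    then show "0 < (INF k. lim (p k))" using \<delta>(1) by linarith
  qed
  finally show ?thesis using True by (simp add: p_def)
next
  case False
  then show ?thesis by (auto simp: carleson_sequence_def subset_eq)
qed

lemma offset_ge: "(\<And>i. 0 < n i) \<Longrightarrow> i \<le> offset n i"
proof (induction i)
  case (Suc i)
  have "i \<le> offset n i" using Suc by blast
  then show ?case using Suc.prems[of i] by (simp add: offset_def)
qed simp

lemma filterlim_offset: "(\<And>i. 0 < n i) \<Longrightarrow> filterlim (offset n) at_top sequentially"
  by (rule filterlim_at_top_mono[OF filterlim_ident]) (simp add: offset_ge)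

text \<open>Every coordinate of the difference is eventually that of \<open>g\<close> minus that of the expansion,
  and is bounded by the norm; conversely, if all coordinates agree, the difference is a tail of \<open>g\<close>.\<close>

lemma block_expansion_converges_iff:
  assumes n: "\<And>i. 0 < n i" and g: "g \<in> ell2"
  shows "(\<lambda>N. ell2_norm (\<lambda>k. g k - (\<Sum>i<N. \<Sum>j<n i. x i j * delta n i j k))) \<longlonglongrightarrow> 0 \<longleftrightarrow>
    (\<forall>i j. j < n i \<longrightarrow> g (j + offset n i) = x i j)"
proof -
  define y where "y k = x (block_of n k) (k - offset n (block_of n k))" for k
  have yx: "y (j + offset n i) = x i j" if "j < n i" for i j
    using block_of_offset[of j n i] that by (simp add: y_def)
  have part: "(\<Sum>i<N. \<Sum>j<n i. x i j * delta n i j k) = (if k < offset n N then y k else 0)" for N k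
  proof -
    have "(\<Sum>i<N. \<Sum>j<n i. x i j * delta n i j k) = (\<Sum>i<N. \<Sum>j<n i. y (j + offset n i) * unit_vec (j + offset n i) k)"
      by (simp add: yx delta_def)
    also have "\<dots> = (\<Sum>l<offset n N. y l * unit_vec l k)" by (rule sum_lessThan_offset[symmetric])
    finally show ?thesis by (simp add: unit_vec_def if_distrib[of "\<lambda>x. _ * x"] cong: if_cong)
  qed
  have gy: "(\<forall>i j. j < n i \<longrightarrow> g (j + offset n i) = x i j) \<longleftrightarrow> g = y"
  proof
    assume l: "\<forall>i j. j < n i \<longrightarrow> g (j + offset n i) = x i j"
    show "g = y"
    proof
      fix k
      obtain i j where "j < n i" "k = j + offset n i" by (rule offset_cases[of n k, OF n])
      then show "g k = y k" using l yx by simp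
    qed
  qed (simp add: yx)
  have "(\<lambda>N. ell2_norm (\<lambda>k. g k - (if k < offset n N then y k else 0))) \<longlonglongrightarrow> 0 \<longleftrightarrow> g = y"
  proof
    assume "g = y"
    then have "(\<lambda>N. ell2_norm (\<lambda>k. g k - (if k < offset n N then y k else 0)))
      = (\<lambda>N. sqrt ((ell2_norm (\<lambda>k. if k < offset n N then 0 else g k))\<^sup>2))"
    proof -
      have "(\<lambda>k. g k - (if k < offset n N then g k else 0)) = (\<lambda>k. if k < offset n N then 0 else g k)" for N
        by auto
      moreover have "0 \<le> ell2_norm (\<lambda>k. if k < offset n N then 0 else g k)" for N
        using ell2_tail(1)[OF g] by (simp add: ell2_norm_def ell2_def suminf_nonneg)
      ultimately show ?thesis unfolding \<open>g = y\<close>[symmetric] by simp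
    qed
    moreover have "\<dots> \<longlonglongrightarrow> sqrt 0"
      by (intro tendsto_intros ell2_tail_tendsto_0 g filterlim_offset n)
    ultimately show "(\<lambda>N. ell2_norm (\<lambda>k. g k - (if k < offset n N then y k else 0))) \<longlonglongrightarrow> 0" by simp
  next
    assume lim: "(\<lambda>N. ell2_norm (\<lambda>k. g k - (if k < offset n N then y k else 0))) \<longlonglongrightarrow> 0"
    show "g = y"
    proof
      fix k
      have "cmod (g k - y k) \<le> ell2_norm (\<lambda>k. g k - (if k < offset n N then y k else 0))" if "Suc k \<le> N" for N
      proof -
        let ?f = "\<lambda>k. g k - (if k < offset n N then y k else 0)"
        have s: "summable (\<lambda>k. (cmod (?f k))\<^sup>2)"
          by (rule iffD1[OF summable_cong[OF eventually_sequentiallyI[of "offset n N"]], of "\<lambda>k. (cmod (g k))\<^sup>2"])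
             (use g in \<open>auto simp: ell2_def\<close>)
        have "k < offset n N" using offset_ge[of n N] n that by fastforce
        then have "(cmod (g k - y k))\<^sup>2 \<le> (\<Sum>k. (cmod (?f k))\<^sup>2)"
          using sum_le_suminf[OF s, of "{k}"] by simp
        then show ?thesis unfolding ell2_norm_def by (rule real_le_rsqrt)
      qed
      then have "cmod (g k - y k) \<le> 0" by (intro LIMSEQ_le_const[OF lim]) blast
      then show "g k = y k" by simp
    qed
  qed
  then show ?thesis unfolding part gy .
qed

section \<open>Orbits that are frames\<close>

lemma orbit_in_ell2:
  assumes "ell2_bounded_operator (jordan_sum n z)" "g \<in> ell2"
  shows "(jordan_sum n z ^^ k) g \<in> ell2"
  using assms by (induction k) (auto simp: ell2_bounded_operator_def)

text \<open>Sufficiency: the symbols of the blocks satisfy two-sided estimates that are uniform in the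
  number of blocks, and these are frame inequalities on finitely supported vectors.\<close>

lemma carleson_imp_orbit_frame:
  fixes n :: "nat \<Rightarrow> nat" and z g :: "nat \<Rightarrow> complex" and c :: "nat \<Rightarrow> nat \<Rightarrow> complex"
  assumes n: "\<And>i. 0 < n i" "bdd_above (range n)"
    and J: "ell2_bounded_operator (jordan_sum n z)" and g: "g \<in> ell2"
    and carl: "carleson_sequence z"
    and gc: "\<And>i j. j < n i \<Longrightarrow> g (j + offset n i) = c i j * of_real (sqrt (1 - (cmod (z i))\<^sup>2))"
    and \<kappa>: "0 < \<kappa>" "\<And>i. \<kappa> \<le> cmod (c i 0)" and C: "\<And>i j. j < n i \<Longrightarrow> cmod (c i j) \<le> C"
  shows "ell2_frame (\<lambda>k. (jordan_sum n z ^^ k) g)"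
proof -
  obtain \<delta> where z: "\<And>i. cmod (z i) < 1" and \<delta>: "0 < \<delta>"
    and sep: "\<And>k N. \<delta> \<le> (\<Prod>j\<in>{..<N} - {k}. cmod (blaschke (z j) (z k)))"
    using carl unfolding carleson_sequence_iff by blast
  have \<delta>1: "\<delta> \<le> 1" using sep[where N = 0] by simp
  obtain m where m: "\<And>i. n i \<le> m" using n(2) by (auto simp: bdd_above_def)
  have m0: "0 < m" using n(1)[of 0] m[of 0] by linarith
  have C0: "0 \<le> C" using C[OF n(1)[of 0]] norm_ge_zero order_trans by blast
  define c' where "c' i j = g (j + offset n i) / of_real (sqrt (1 - (cmod (z i))\<^sup>2))" for i j
  have cc: "c' i j = c i j" if "j < n i" for i j
    using gc[OF that] one_minus_cmod_sq_pos[OF z[of i]] by (simp add: c'_def)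
  obtain A B where A: "0 < A" and riesz: "\<And>N \<eta>.
      A * (\<Sum>i<N. \<Sum>r<n i. (cmod (\<eta> i r))\<^sup>2)
        \<le> circle_sq (\<lambda>w. \<Sum>i<N. \<Sum>r<n i. \<eta> i r * block_symbol (c' i) (z i) r w)"
      "\<And>N \<eta>. circle_sq (\<lambda>w. \<Sum>i<N. \<Sum>r<n i. \<eta> i r * block_symbol (c' i) (z i) r w)
        \<le> B * (\<Sum>i<N. \<Sum>r<n i. (cmod (\<eta> i r))\<^sup>2)"
  proof -
    obtain A B where A: "0 < A" and r: "\<forall>N (n :: nat \<Rightarrow> nat) (z :: nat \<Rightarrow> complex) c \<eta>.
      (\<forall>i. n i \<le> m) \<longrightarrow> (\<forall>i. cmod (z i) < 1) \<longrightarrow>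
      (\<forall>j. \<delta> \<le> (\<Prod>k\<in>{..<N} - {j}. cmod (blaschke (z k) (z j)))) \<longrightarrow>
      (\<forall>i. \<kappa> \<le> cmod (c i 0)) \<longrightarrow> (\<forall>i j. j < n i \<longrightarrow> cmod (c i j) \<le> C) \<longrightarrow>
      A * (\<Sum>i<N. \<Sum>r<n i. (cmod (\<eta> i r))\<^sup>2)
        \<le> circle_sq (\<lambda>w. \<Sum>i<N. \<Sum>r<n i. \<eta> i r * block_symbol (c i) (z i) r w) \<and>
      circle_sq (\<lambda>w. \<Sum>i<N. \<Sum>r<n i. \<eta> i r * block_symbol (c i) (z i) r w)
        \<le> B * (\<Sum>i<N. \<Sum>r<n i. (cmod (\<eta> i r))\<^sup>2)"
      using block_symbols_riesz[OF \<delta> \<delta>1 m0 \<kappa>(1) C0] by (elim exE conjE)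
    have "\<forall>i. \<kappa> \<le> cmod (c' i 0)" "\<forall>i j. j < n i \<longrightarrow> cmod (c' i j) \<le> C"
      using cc n(1) \<kappa>(2) C by auto
    then show ?thesis
      by (intro that[of A B, OF A] r[rule_format, THEN conjunct1] r[rule_format, THEN conjunct2])
         (use m z sep in auto)
  qed
  let ?F = "\<lambda>k. (jordan_sum n z ^^ k) g"
  have norm: "(ell2_norm h)\<^sup>2 = (\<Sum>i<N. \<Sum>r<n i. (cmod (h (r + offset n i)))\<^sup>2)"
    if "\<And>k. offset n N \<le> k \<Longrightarrow> h k = 0" for h N
    using ell2_norm_sq_finite[OF that] by (simp add: sum_lessThan_offset)
  have sums: "(\<lambda>k. (cmod (ell2_inner h (?F k)))\<^sup>2) sums
      circle_sq (\<lambda>w. \<Sum>i<N. \<Sum>r<n i. h (r + offset n i) * block_symbol (c' i) (z i) r w)"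
    if "\<And>k. offset n N \<le> k \<Longrightarrow> h k = 0" for h N
    using orbit_analysis_parseval[of z n N h g, OF z that] unfolding c'_def by simp
  show ?thesis
  proof (rule ell2_frame_from_finite_support[OF orbit_in_ell2[OF J g] A filterlim_offset[of n, OF n(1)]])
    fix h :: "nat \<Rightarrow> complex" and N assume h0: "\<And>k. offset n N \<le> k \<Longrightarrow> h k = 0"
    have nm: "(ell2_norm h)\<^sup>2 = (\<Sum>i<N. \<Sum>r<n i. (cmod (h (r + offset n i)))\<^sup>2)"
      by (rule norm) (rule h0)
    have sm: "(\<lambda>k. (cmod (ell2_inner h (?F k)))\<^sup>2) sums
        circle_sq (\<lambda>w. \<Sum>i<N. \<Sum>r<n i. h (r + offset n i) * block_symbol (c' i) (z i) r w)"
      by (rule sums) (rule h0)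
    show "summable (\<lambda>k. (cmod (ell2_inner h (?F k)))\<^sup>2)" using sm by (rule sums_summable)
    show "A * (ell2_norm h)\<^sup>2 \<le> (\<Sum>k. (cmod (ell2_inner h (?F k)))\<^sup>2)"
      unfolding sums_unique[OF sm, symmetric] nm by (rule riesz)
    show "(\<Sum>k. (cmod (ell2_inner h (?F k)))\<^sup>2) \<le> B * (ell2_norm h)\<^sup>2"
      unfolding sums_unique[OF sm, symmetric] nm by (rule riesz)
  qed
qed

text \<open>Necessity: the frame inequalities are tested on single basis vectors, which yields
  \<open>\<bar>z i\<bar> < 1\<close> and the bounds for \<open>c\<close>, and then on vectors supported on the first coordinates of
  the blocks. The symbols of the latter are multiples of kernels, so that
  \<open>szego_riesz_imp_separated\<close> applies.\<close>

lemma orbit_frame_imp: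
  fixes n :: "nat \<Rightarrow> nat" and z g :: "nat \<Rightarrow> complex"
  assumes n: "\<And>i. 0 < n i" and frame: "ell2_frame (\<lambda>k. (jordan_sum n z ^^ k) g)"
  defines "c \<equiv> \<lambda>i j. g (j + offset n i) / of_real (sqrt (1 - (cmod (z i))\<^sup>2))"
  shows "carleson_sequence z" and "\<exists>\<kappa>>0. \<forall>i. \<kappa> \<le> cmod (c i 0)"
    and "\<exists>C. \<forall>i j. j < n i \<longrightarrow> cmod (c i j) \<le> C"
proof -
  let ?F = "\<lambda>k. (jordan_sum n z ^^ k) g"
  obtain A B where A: "0 < A" "A \<le> B" and fr: "\<And>h. h \<in> ell2 \<Longrightarrow> summable (\<lambda>k. (cmod (ell2_inner h (?F k)))\<^sup>2)"
    "\<And>h. h \<in> ell2 \<Longrightarrow> A * (ell2_norm h)\<^sup>2 \<le> (\<Sum>k. (cmod (ell2_inner h (?F k)))\<^sup>2)"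
    "\<And>h. h \<in> ell2 \<Longrightarrow> (\<Sum>k. (cmod (ell2_inner h (?F k)))\<^sup>2) \<le> B * (ell2_norm h)\<^sup>2"
    using frame unfolding ell2_frame_def by auto
  have fin: "h \<in> ell2" if "\<And>k. P \<le> k \<Longrightarrow> h k = 0" for h P
    unfolding ell2_def using that by (auto intro!: summable_finite[of "{..<P}"]) (meson not_le)
  have z: "cmod (z i) < 1" for i
  proof -
    let ?o = "offset n i" and ?e = "unit_vec (offset n i)"
    have F: "?F k ?o = z i ^ k * g ?o" for k
      by (induction k) (use jordan_sum_coordinate[of 0 n i] n in simp_all)
    have e0: "?e k = 0" if "Suc ?o \<le> k" for k using that by (auto simp: unit_vec_def)
    have e: "?e \<in> ell2" by (rule fin) (rule e0)
    have "ell2_inner ?e (?F k) = cnj (z i ^ k * g ?o)" for k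
      by (subst ell2_inner_finite[of "Suc ?o", OF e0], assumption)
         (simp add: unit_vec_def F if_distrib[of "\<lambda>x. x * _"] cong: if_cong)
    then have eq: "(\<lambda>k. (cmod (ell2_inner ?e (?F k)))\<^sup>2) = (\<lambda>k. ((cmod (z i))\<^sup>2) ^ k * (cmod (g ?o))\<^sup>2)"
      by (simp add: norm_mult norm_power power_mult_distrib mult.commute flip: power_mult)
    have "(ell2_norm ?e)\<^sup>2 = 1"
      by (subst ell2_norm_sq_finite[of "Suc ?o", OF e0], assumption)
         (simp add: unit_vec_def if_distrib[of cmod] if_distrib[of "\<lambda>x. x ^ _"] cong: if_cong)
    then have "A \<le> (\<Sum>k. ((cmod (z i))\<^sup>2) ^ k * (cmod (g ?o))\<^sup>2)"
      using fr(2)[OF e] unfolding eq by simp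
    then have "g ?o \<noteq> 0" using A(1) by auto
    moreover have "summable (\<lambda>k. ((cmod (z i))\<^sup>2) ^ k * (cmod (g ?o))\<^sup>2)"
      using fr(1)[OF e] unfolding eq .
    ultimately have "summable (\<lambda>k. ((cmod (z i))\<^sup>2) ^ k)"
      unfolding mult.commute[of _ "(cmod (g ?o))\<^sup>2"] summable_cmult_iff by simp
    then show ?thesis by (simp add: summable_geometric_iff power_less_one_iff)
  qed
  define sy where "sy i r = block_symbol (c i) (z i) r" for i r
  have contsy: "continuous_on (sphere 0 1) (sy i r)" for i r
  proof (induction r)
    case 0
    then show ?case unfolding sy_def
      by (auto intro!: continuous_intros analytic_continuous_circle[OF analytic_szego[OF z]])
  next
    case (Suc r)
    then show ?case unfolding sy_def
      by (auto intro!: continuous_intros analytic_continuous_circle[OF analytic_szego[OF z]]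
         analytic_continuous_circle[OF analytic_blaschke[OF z]])
  qed
  have riesz: "A * (\<Sum>i<N. \<Sum>r<n i. (cmod (\<eta> i r))\<^sup>2) \<le> circle_sq (\<lambda>w. \<Sum>i<N. \<Sum>r<n i. \<eta> i r * sy i r w)"
    "circle_sq (\<lambda>w. \<Sum>i<N. \<Sum>r<n i. \<eta> i r * sy i r w) \<le> B * (\<Sum>i<N. \<Sum>r<n i. (cmod (\<eta> i r))\<^sup>2)" for N \<eta>
  proof -
    define h where "h k = (if k < offset n N then \<eta> (block_of n k) (k - offset n (block_of n k)) else 0)" for k
    have h0: "h k = 0" if "offset n N \<le> k" for k using that by (simp add: h_def)
    have h\<eta>: "h (r + offset n i) = \<eta> i r" if "i < N" "r < n i" for i r
    proof -
      have "offset n (Suc i) \<le> offset n N" using that by (intro offset_mono) auto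
      then have "r + offset n i < offset n N" using that by (simp add: offset_def)
      then show ?thesis using block_of_offset[of r n i] that by (simp add: h_def)
    qed
    have norm: "(ell2_norm h)\<^sup>2 = (\<Sum>i<N. \<Sum>r<n i. (cmod (\<eta> i r))\<^sup>2)"
      using ell2_norm_sq_finite[of "offset n N" h, OF h0] by (simp add: sum_lessThan_offset h\<eta>)
    have "(\<lambda>k. (cmod (ell2_inner h (?F k)))\<^sup>2) sums
        circle_sq (\<lambda>w. \<Sum>i<N. \<Sum>r<n i. h (r + offset n i) * block_symbol (c i) (z i) r w)"
      using orbit_analysis_parseval[of z n N h g, OF z h0] unfolding c_def by simp
    then have "(\<Sum>k. (cmod (ell2_inner h (?F k)))\<^sup>2) = circle_sq (\<lambda>w. \<Sum>i<N. \<Sum>r<n i. \<eta> i r * sy i r w)"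
      by (simp add: h\<eta> sums_unique[symmetric] sy_def)
    moreover have "h \<in> ell2" by (rule fin) (rule h0)
    ultimately show "A * (\<Sum>i<N. \<Sum>r<n i. (cmod (\<eta> i r))\<^sup>2) \<le> circle_sq (\<lambda>w. \<Sum>i<N. \<Sum>r<n i. \<eta> i r * sy i r w)"
      "circle_sq (\<lambda>w. \<Sum>i<N. \<Sum>r<n i. \<eta> i r * sy i r w) \<le> B * (\<Sum>i<N. \<Sum>r<n i. (cmod (\<eta> i r))\<^sup>2)"
      using fr(2,3)[of h] unfolding norm by simp_all
  qed
  have single: "A \<le> circle_sq (sy i r)" "circle_sq (sy i r) \<le> B" if "r < n i" for i r
  proof -
    let ?\<eta> = "\<lambda>j s. if j = i then if s = r then 1 else 0 else 0 :: complex"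
    have s: "(\<Sum>j<Suc i. \<Sum>s<n j. ?\<eta> j s * x j s) = x i r" for x :: "nat \<Rightarrow> nat \<Rightarrow> complex"
      using that by (simp add: if_distrib[of "\<lambda>x. x * _"] cong: if_cong)
    have n1: "(\<Sum>j<Suc i. \<Sum>s<n j. (cmod (?\<eta> j s))\<^sup>2) = 1"
      using that by (simp add: if_distrib[of cmod] if_distrib[of "\<lambda>x. x ^ _"] cong: if_cong)
    have sq: "circle_sq (\<lambda>w. \<Sum>j<Suc i. \<Sum>s<n j. ?\<eta> j s * sy j s w) = circle_sq (sy i r)"
      by (rule circle_sq_cong) (simp only: s[of "\<lambda>j s. sy j s _"])
    show "A \<le> circle_sq (sy i r)" "circle_sq (sy i r) \<le> B"
      using riesz[of ?\<eta> "Suc i"] unfolding sq n1 by simp_all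
  qed
  have sqc: "circle_sq (\<lambda>w. cnj (c i r) * szego (z i) w) = (cmod (c i r))\<^sup>2" for i r
    by (simp add: circle_sq_cmult circle_sq_szego z)
  have sy0: "sy i 0 = (\<lambda>w. cnj (c i 0) * szego (z i) w)" for i by (simp add: sy_def fun_eq_iff)
  have c0: "A \<le> (cmod (c i 0))\<^sup>2" for i
    using single(1)[OF n[of i]] unfolding sy0 sqc .
  \<comment> \<open>\<open>c i r\<close> is the coefficient of the kernel in the difference of the symbol with index \<open>r\<close> and
    \<open>b + z i\<close> times the one before it, and \<open>\<bar>b + z i\<bar> \<le> 2\<close> on the circle.\<close>
  have cB: "(cmod (c i r))\<^sup>2 \<le> 10 * B" if r: "r < n i" for i r
  proof (cases r)
    case 0
    then show ?thesis using single(2)[OF n[of i]] A unfolding sy0 sqc by simp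
  next
    case (Suc s)
    let ?u = "\<lambda>w. - (blaschke (z i) w + z i) * sy i s w"
    have contu: "continuous_on (sphere 0 1) ?u"
      by (intro continuous_intros contsy analytic_continuous_circle[OF analytic_blaschke[OF z]])
    have "(cmod (c i r))\<^sup>2 = circle_sq (\<lambda>w. sy i r w + ?u w)"
      unfolding sqc[symmetric] by (simp add: Suc sy_def algebra_simps)
    also have "\<dots> \<le> 2 * circle_sq (sy i r) + 2 * circle_sq ?u"
      by (rule circle_sq_add_le[OF contsy contu])
    also have "circle_sq ?u \<le> circle_mean (\<lambda>w. 4 * (cmod (sy i s w))\<^sup>2)"
      unfolding circle_sq_def
    proof (rule circle_mean_mono)
      fix w :: complex assume w: "cmod w = 1"
      have "cmod (blaschke (z i) w + z i) \<le> 2"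
        using norm_triangle_ineq[of "blaschke (z i) w" "z i"] cmod_blaschke_circle[OF z[of i] w] z[of i] by linarith
      then have "(cmod (blaschke (z i) w + z i))\<^sup>2 \<le> 2\<^sup>2" by (intro power_mono) auto
      then have "(cmod (blaschke (z i) w + z i))\<^sup>2 * (cmod (sy i s w))\<^sup>2 \<le> 4 * (cmod (sy i s w))\<^sup>2"
        by (intro mult_right_mono) auto
      then show "(cmod (- (blaschke (z i) w + z i) * sy i s w))\<^sup>2 \<le> 4 * (cmod (sy i s w))\<^sup>2"
        by (simp only: norm_mult norm_minus_cancel power_mult_distrib)
    qed (intro continuous_intros contu contsy)+
    also have "circle_mean (\<lambda>w. 4 * (cmod (sy i s w))\<^sup>2) = 4 * circle_sq (sy i s)"
      by (simp add: circle_sq_def circle_mean_cmult)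
    finally show ?thesis using single(2)[OF r] single(2)[of s i] r Suc by simp
  qed
  show "\<exists>\<kappa>>0. \<forall>i. \<kappa> \<le> cmod (c i 0)"
    using A(1) c0 by (intro exI[of _ "sqrt A"]) (auto intro!: real_le_lsqrt)
  show "\<exists>C. \<forall>i j. j < n i \<longrightarrow> cmod (c i j) \<le> C"
    using cB by (intro exI[of _ "sqrt (10 * B)"]) (auto intro!: real_le_rsqrt)
  \<comment> \<open>Dividing by \<open>cnj (c j 0)\<close> turns symbols with index \<open>0\<close> into kernels, at the cost of the
    upper bound \<open>10 * B\<close> for \<open>\<bar>c j 0\<bar>\<^sup>2\<close>.\<close>
  define A' where "A' = A / (10 * B)"
  have A': "0 < A'" using A by (simp add: A'_def)
  have kernels: "A' * (\<Sum>j\<in>S. (cmod (h j))\<^sup>2) \<le> circle_sq (\<lambda>w. \<Sum>j\<in>S. h j * szego (z j) w)"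
    if S: "finite S" for S h
  proof -
    obtain N where N: "S \<subseteq> {..<N}" using finite_nat_iff_bounded S by blast
    let ?\<eta> = "\<lambda>j r. if r = 0 \<and> j \<in> S then h j / cnj (c j 0) else 0"
    have cnz: "c j 0 \<noteq> 0" for j using c0[of j] A(1) by auto
    have inner: "(\<Sum>r<n j. if r = 0 \<and> j \<in> S then x r else 0) = (if j \<in> S then x 0 else 0 :: 'a :: comm_monoid_add)" for j x
      using n[of j] by (cases "j \<in> S") auto
    have outer: "(\<Sum>j<N. if j \<in> S then x j else 0) = (\<Sum>j\<in>S. x j :: 'a :: comm_monoid_add)" for x
      using N by (simp add: sum.inter_restrict[symmetric] Int_absorb1)
    have "(\<Sum>j<N. \<Sum>r<n j. ?\<eta> j r * sy j r w) = (\<Sum>j\<in>S. h j * szego (z j) w)" for w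
    proof -
      have "(\<Sum>j<N. \<Sum>r<n j. ?\<eta> j r * sy j r w)
        = (\<Sum>j<N. \<Sum>r<n j. if r = 0 \<and> j \<in> S then h j / cnj (c j 0) * sy j r w else 0)"
        by (intro sum.cong refl) auto
      also have "\<dots> = (\<Sum>j\<in>S. h j / cnj (c j 0) * sy j 0 w)" unfolding inner outer ..
      finally show ?thesis using cnz by (simp add: sy0)
    qed
    moreover have "(\<Sum>j<N. \<Sum>r<n j. (cmod (?\<eta> j r))\<^sup>2) = (\<Sum>j\<in>S. (cmod (h j / cnj (c j 0)))\<^sup>2)"
    proof -
      have "(\<Sum>j<N. \<Sum>r<n j. (cmod (?\<eta> j r))\<^sup>2)
        = (\<Sum>j<N. \<Sum>r<n j. if r = 0 \<and> j \<in> S then (cmod (h j / cnj (c j 0)))\<^sup>2 else 0)"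
        by (intro sum.cong refl) auto
      then show ?thesis unfolding inner outer .
    qed
    ultimately have "A * (\<Sum>j\<in>S. (cmod (h j / cnj (c j 0)))\<^sup>2) \<le> circle_sq (\<lambda>w. \<Sum>j\<in>S. h j * szego (z j) w)"
      using riesz(1)[of ?\<eta> N] by simp
    moreover have "(cmod (h j))\<^sup>2 / (10 * B) \<le> (cmod (h j / cnj (c j 0)))\<^sup>2" for j
      using cB[OF n[of j]] cnz[of j] A unfolding norm_divide power_divide
      by (intro divide_left_mono) auto
    then have "A * (\<Sum>j\<in>S. (cmod (h j))\<^sup>2 / (10 * B)) \<le> A * (\<Sum>j\<in>S. (cmod (h j / cnj (c j 0)))\<^sup>2)"
      using A(1) by (intro mult_left_mono sum_mono) auto
    ultimately show ?thesis by (simp add: A'_def sum_divide_distrib[symmetric])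
  qed
  \<comment> \<open>If two points coincided, the difference of their kernels would vanish.\<close>
  have inj: "inj z"
  proof (rule injI, rule ccontr)
    fix i j assume ij: "z i = z j" "i \<noteq> j"
    have "circle_sq (\<lambda>w. 0) = 0" by (simp add: circle_sq_def circle_mean_const)
    then show False using kernels[of "{i, j}" "\<lambda>k. if k = i then 1 else - 1"] ij A' by simp
  qed
  show "carleson_sequence z"
    unfolding carleson_sequence_iff
  proof (intro conjI allI z exI[of _ "sqrt A'"])
    show "0 < sqrt A'" using A' by simp
    fix k N
    have "inj_on z (insert k ({..<N} - {k}))" using inj by (rule inj_on_subset) simp
    then have "A' \<le> (\<Prod>j\<in>{..<N} - {k}. cmod (blaschke (z j) (z k)))\<^sup>2"
      by (intro szego_riesz_imp_separated z less_imp_le[OF A'] kernels) simp_all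
    then show "sqrt A' \<le> (\<Prod>j\<in>{..<N} - {k}. cmod (blaschke (z j) (z k)))"
      by (intro real_le_lsqrt) (auto simp: prod_nonneg)
  qed
qed

theorem theorem1p2:
  fixes n :: "nat \<Rightarrow> nat" and z :: "nat \<Rightarrow> complex" and g :: "nat \<Rightarrow> complex"
  assumes "\<And>i. 0 < n i"
    and "bdd_above (range n)"
    and "ell2_bounded_operator (jordan_sum n z)"
    and "g \<in> ell2"
  shows "ell2_frame (\<lambda>k. (jordan_sum n z ^^ k) g) \<longleftrightarrow>
    carleson_sequence z \<and>
    (\<exists>c :: nat \<Rightarrow> nat \<Rightarrow> complex.
       (\<lambda>N. ell2_norm (\<lambda>k. g k -
          (\<Sum>i<N. \<Sum>j<n i. c i j * of_real (sqrt (1 - (cmod (z i))\<^sup>2)) * delta n i j k)))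
         \<longlonglongrightarrow> 0 \<and>
       (INF i. cmod (c i 0)) > 0 \<and>
       bdd_above {cmod (c i j) | i j. j < n i})"
    (is "?frame \<longleftrightarrow> ?rhs")
proof
  assume fr: ?frame
  define c where "c i j = g (j + offset n i) / of_real (sqrt (1 - (cmod (z i))\<^sup>2))" for i j
  have carl: "carleson_sequence z" by (rule orbit_frame_imp(1)[OF assms(1) fr])
  then have z: "cmod (z i) < 1" for i by (simp add: carleson_sequence_iff)
  obtain \<kappa> where \<kappa>: "0 < \<kappa>" "\<And>i. \<kappa> \<le> cmod (c i 0)"
    using orbit_frame_imp(2)[OF assms(1) fr] unfolding c_def by blast
  obtain C where C: "\<And>i j. j < n i \<Longrightarrow> cmod (c i j) \<le> C"
    using orbit_frame_imp(3)[OF assms(1) fr] unfolding c_def by blast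
  have "g (j + offset n i) = c i j * of_real (sqrt (1 - (cmod (z i))\<^sup>2))" for i j
    using one_minus_cmod_sq_pos[OF z[of i]] by (simp add: c_def)
  moreover have "\<kappa> \<le> (INF i. cmod (c i 0))" by (rule cINF_greatest) (auto intro: \<kappa>)
  moreover have "bdd_above {cmod (c i j) | i j. j < n i}"
    by (rule bdd_aboveI[of _ C]) (use C in blast)
  ultimately show ?rhs
    using carl \<kappa>(1) block_expansion_converges_iff[of n g, OF assms(1,4)]
    by (intro conjI exI[of _ c]) auto
next
  assume ?rhs
  then obtain c where carl: "carleson_sequence z"
    and lim: "(\<lambda>N. ell2_norm (\<lambda>k. g k -
          (\<Sum>i<N. \<Sum>j<n i. c i j * of_real (sqrt (1 - (cmod (z i))\<^sup>2)) * delta n i j k))) \<longlonglongrightarrow> 0"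
    and inf: "(INF i. cmod (c i 0)) > 0" and bdd: "bdd_above {cmod (c i j) | i j. j < n i}" by blast
  obtain C where C: "\<And>i j. j < n i \<Longrightarrow> cmod (c i j) \<le> C"
    using bdd unfolding bdd_above_def by blast
  have "(INF i. cmod (c i 0)) \<le> cmod (c i 0)" for i
    by (rule cINF_lower) (auto simp: bdd_below_def intro!: exI[of _ 0])
  moreover have "g (j + offset n i) = c i j * of_real (sqrt (1 - (cmod (z i))\<^sup>2))" if "j < n i" for i j
    using lim that unfolding block_expansion_converges_iff[of n g, OF assms(1,4)] by blast
  ultimately show ?frame using inf C
    by (intro carleson_imp_orbit_frame[OF assms carl])
qed

end
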